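(* Let $X$ be a Tychonoff space. Then the free locally convex space $L(X)$ is a $\kappa$-Fréchet--Urysohn space if and only if $X$ is finite.
   Context: A topological space $Y$ is $\kappa$-Fréchet--Urysohn if for every open subset $U$ of $Y$ and every $y\in\overline{U}$ there exists a sequence $\{y_n\}_{n\in\mathbb{N}}\subseteq U$ converging to $y$. Locally convex spaces are Hausdorff and over a field $\mathbf{F}=\mathbb{R}$ or $\mathbb{C}$. The free locally convex space $L(X)$ on a Tychonoff space $X$ is a pair consisting of a locally convex space $L(X)$ and a continuous map $i:X\to L(X)$ such that every continuous map $f$ from $X$ to a locally convex space $E$ gives rise to a unique continuous linear operator $\bar f:L(X)\to E$ with $f=\bar f\circ i$. It always exists and is essentially unique. *)

theory Defs
  imports "HOL-Algebra.Module" "HOL-Analysis.Analysis"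
begin

section \<open>\<open>\<kappa>\<close>-Frechet--Urysohn spaces\<close>

definition kappa_Frechet_Urysohn_space :: "'a topology \<Rightarrow> bool" where
  "kappa_Frechet_Urysohn_space Y \<longleftrightarrow>
     (\<forall>U y. openin Y U \<and> y \<in> Abstract_Topology.closure_of Y U \<longrightarrow>
        (\<exists>s::nat \<Rightarrow> 'a. range s \<subseteq> U \<and> limitin Y s y sequentially))"


section \<open>Locally convex spaces over the real or complex field\<close>

text \<open>
  The scalar field is a subset \<open>F\<close> of the complex numbers, to be instantiated with \<^term>\<open>\<real>\<close> or
  \<^term>\<open>UNIV\<close>, always with the topology \<^term>\<open>top_of_set F\<close>. A vector space over \<open>F\<close> is a
  module over the following ring. (The multiplicative structure that the record type
  \<open>module\<close> also provides on the vectors is irrelevant.)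
\<close>

definition scalar_field :: "complex set \<Rightarrow> complex ring" where
  "scalar_field F = \<lparr>carrier = F, monoid.mult = (*), one = 1, zero = 0, add = (+)\<rparr>"

definition convex_subset :: "(complex, 'v, 'm) module_scheme \<Rightarrow> 'v set \<Rightarrow> bool" where
  "convex_subset E V \<longleftrightarrow> V \<subseteq> carrier E \<and>
     (\<forall>x\<in>V. \<forall>y\<in>V. \<forall>t::real. 0 \<le> t \<and> t \<le> 1 \<longrightarrow>
        (complex_of_real t \<odot>\<^bsub>E\<^esub> x) \<oplus>\<^bsub>E\<^esub> (complex_of_real (1 - t) \<odot>\<^bsub>E\<^esub> y) \<in> V)"

definition locally_convex_space ::
  "complex set \<Rightarrow> (complex, 'v, 'm) module_scheme \<Rightarrow> 'v topology \<Rightarrow> bool" where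
  "locally_convex_space F E T \<longleftrightarrow>
     Module.module (scalar_field F) E \<and>
     topspace T = carrier E \<and>
     Hausdorff_space T \<and>
     continuous_map (prod_topology T T) T (\<lambda>(x, y). x \<oplus>\<^bsub>E\<^esub> y) \<and>
     continuous_map (prod_topology (top_of_set F) T) T (\<lambda>(a, x). a \<odot>\<^bsub>E\<^esub> x) \<and>
     (\<forall>U. openin T U \<and> \<zero>\<^bsub>E\<^esub> \<in> U \<longrightarrow>
        (\<exists>V. openin T V \<and> convex_subset E V \<and> \<zero>\<^bsub>E\<^esub> \<in> V \<and> V \<subseteq> U))"

definition linear_operator ::
  "complex set \<Rightarrow> (complex, 'v, 'm) module_scheme \<Rightarrow> (complex, 'w, 'n) module_scheme
     \<Rightarrow> ('v \<Rightarrow> 'w) \<Rightarrow> bool" where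
  "linear_operator F E E' g \<longleftrightarrow>
     g \<in> carrier E \<rightarrow> carrier E' \<and>
     (\<forall>x\<in>carrier E. \<forall>y\<in>carrier E. g (x \<oplus>\<^bsub>E\<^esub> y) = g x \<oplus>\<^bsub>E'\<^esub> g y) \<and>
     (\<forall>a\<in>F. \<forall>x\<in>carrier E. g (a \<odot>\<^bsub>E\<^esub> x) = a \<odot>\<^bsub>E'\<^esub> g x)"


section \<open>Free locally convex spaces\<close>

text \<open>
  The universal property of \<open>(L, i)\<close> with respect to all locally convex spaces \<open>E\<close> whose
  vectors are elements of the type \<open>'e\<close>. Operators are made extensional
  so that they are unique as functions on the carrier of \<open>L\<close>.
\<close>

definition free_universal_property ::
  "'e itself \<Rightarrow> complex set \<Rightarrow> 'x topology \<Rightarrow> (complex, 'v) module \<Rightarrow> 'v topology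
     \<Rightarrow> ('x \<Rightarrow> 'v) \<Rightarrow> bool" where
  "free_universal_property _ F X L T i \<longleftrightarrow>
     (\<forall>(E :: (complex, 'e) module) TE f.
        locally_convex_space F E TE \<and> continuous_map X TE f \<longrightarrow>
        (\<exists>!g. g \<in> extensional (carrier L) \<and> linear_operator F L E g \<and>
              continuous_map T TE g \<and> (\<forall>x\<in>topspace X. g (i x) = f x)))"

text \<open>
  HOL cannot quantify over the type of the vectors of \<open>E\<close>, so a type has to be fixed that is
  large enough. The type below contains copies of \<open>L\<close> and of the linear span of
  any image of \<open>X\<close>, and this suffices: \<open>free_lcs_universal\<close> below derives the universal property
  for locally convex spaces of arbitrary type.
\<close>

definition free_locally_convex_space ::
  "complex set \<Rightarrow> 'x topology \<Rightarrow> (complex, 'v) module \<Rightarrow> 'v topology \<Rightarrow> ('x \<Rightarrow> 'v) \<Rightarrow> bool" where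
  "free_locally_convex_space F X L T i \<longleftrightarrow>
     locally_convex_space F L T \<and> continuous_map X T i \<and>
     free_universal_property TYPE('v + ('x \<Rightarrow> complex)) F X L T i"


section \<open>Independence of the type of the test spaces\<close>

text \<open>A linear subspace \<open>S\<close> of \<open>E\<close>, relabelled along an injection \<open>j\<close>.\<close>

definition relabel :: "('v \<Rightarrow> 'w) \<Rightarrow> 'v set \<Rightarrow> (complex, 'v) module \<Rightarrow> (complex, 'w) module" where
  "relabel j S E = \<lparr>carrier = j ` S, monoid.mult = undefined, one = undefined, zero = j \<zero>\<^bsub>E\<^esub>,
     add = (\<lambda>a b. j (inv_into S j a \<oplus>\<^bsub>E\<^esub> inv_into S j b)),
     module.smult = (\<lambda>c a. j (c \<odot>\<^bsub>E\<^esub> inv_into S j a))\<rparr>"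

definition linear_subspace :: "complex set \<Rightarrow> (complex, 'v) module \<Rightarrow> 'v set \<Rightarrow> bool" where
  "linear_subspace F E S \<longleftrightarrow> S \<subseteq> carrier E \<and> \<zero>\<^bsub>E\<^esub> \<in> S \<and>
     (\<forall>x\<in>S. \<forall>y\<in>S. x \<oplus>\<^bsub>E\<^esub> y \<in> S) \<and> (\<forall>a\<in>F. \<forall>x\<in>S. a \<odot>\<^bsub>E\<^esub> x \<in> S)"

lemma continuous_map_relabel:
  assumes j: "inj_on j S" and h: "continuous_map Y TE h" and hS: "h ` topspace Y \<subseteq> S"
  shows "continuous_map Y (pullback_topology (j ` S) (inv_into S j) TE) (\<lambda>x. j (h x))"
proof (rule continuous_map_pullback')
  show "continuous_map Y TE (inv_into S j \<circ> (\<lambda>x. j (h x)))"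
    by (rule continuous_map_eq[OF h]) (use j hS in auto)
qed (use hS in auto)

lemma relabel_lcs:
  assumes F: "F = \<real> \<or> F = UNIV" and E: "locally_convex_space F E TE"
    and S: "linear_subspace F E S" and j: "inj_on j S"
  defines "T' \<equiv> pullback_topology (j ` S) (inv_into S j) TE"
  shows "locally_convex_space F (relabel j S E) T'"
    and "linear_operator F (relabel j S E) E (inv_into S j)"
    and "continuous_map T' TE (inv_into S j)"
proof -
  interpret E: Module.module "scalar_field F" E
    using E by (simp add: locally_convex_space_def)
  have top: "topspace TE = carrier E" using E by (simp add: locally_convex_space_def)
  have SE: "S \<subseteq> carrier E" and S0: "\<zero>\<^bsub>E\<^esub> \<in> S"
    and Sadd: "\<And>x y. x \<in> S \<Longrightarrow> y \<in> S \<Longrightarrow> x \<oplus>\<^bsub>E\<^esub> y \<in> S"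
    and Ssm: "\<And>a x. a \<in> F \<Longrightarrow> x \<in> S \<Longrightarrow> a \<odot>\<^bsub>E\<^esub> x \<in> S"
    using S by (auto simp: linear_subspace_def)
  have SE': "x \<in> carrier E" if "x \<in> S" for x using SE that by auto
  have ij[simp]: "inv_into S j (j x) = x" if "x \<in> S" for x using j that by simp
  have m1: "- 1 \<in> F" and one: "1 \<in> F" using F by auto
  have tF: "complex_of_real t \<in> F" for t using F by auto
  have neg: "((- 1) \<odot>\<^bsub>E\<^esub> x) \<oplus>\<^bsub>E\<^esub> x = \<zero>\<^bsub>E\<^esub>" if "x \<in> carrier E" for x
    using E.smult_l_distr[of "-1" 1 x] E.smult_one[OF that] E.smult_l_null[OF that] m1 one that
    by (simp add: scalar_field_def)
  let ?E = "relabel j S E"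
  have top': "topspace T' = j ` S"
    using SE' by (auto simp: T'_def topspace_pullback_topology top)
  show cont: "continuous_map T' TE (inv_into S j)"
    using continuous_map_pullback[of TE TE id "j ` S" "inv_into S j"] by (simp add: T'_def)
  note into = continuous_map_relabel[OF j, where TE = TE, folded T'_def]
  show "linear_operator F ?E E (inv_into S j)"
    unfolding linear_operator_def relabel_def using SE' Sadd Ssm by auto
  have ab: "abelian_group ?E"
  proof (rule abelian_groupI)
    fix x assume "x \<in> carrier ?E"
    then obtain s where s: "s \<in> S" "x = j s" by (auto simp: relabel_def)
    show "\<exists>y\<in>carrier ?E. y \<oplus>\<^bsub>?E\<^esub> x = \<zero>\<^bsub>?E\<^esub>"
      by (rule bexI[of _ "j ((-1) \<odot>\<^bsub>E\<^esub> s)"])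
        (use s Ssm[OF m1] SE' neg in \<open>auto simp: relabel_def\<close>)
  qed (use SE' Sadd S0 in \<open>auto simp: relabel_def E.M.a_assoc intro: E.M.a_comm\<close>,
       use SE' Sadd S0 in \<open>auto simp: E.M.a_comm\<close>)
  have mod: "Module.module (scalar_field F) ?E"
  proof (rule Module.moduleI)
    show "cring (scalar_field F)" by (rule E.R.is_cring)
    show "abelian_group ?E" by (rule ab)
  qed (use SE' Sadd Ssm one in \<open>auto simp: relabel_def scalar_field_def
        E.smult_l_distr[unfolded scalar_field_def, simplified]
        E.smult_r_distr[unfolded scalar_field_def, simplified]
        E.smult_assoc1[unfolded scalar_field_def, simplified]
        E.smult_one[unfolded scalar_field_def, simplified]\<close>)
  have haus: "Hausdorff_space T'"
    by (rule Hausdorff_space_injective_preimage[OF _ cont])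
      (use E in \<open>auto simp: locally_convex_space_def top' inj_on_inv_into\<close>)
  have addE: "continuous_map (prod_topology TE TE) TE (\<lambda>(x, y). x \<oplus>\<^bsub>E\<^esub> y)"
    and smE: "continuous_map (prod_topology (top_of_set F) TE) TE (\<lambda>(a, x). a \<odot>\<^bsub>E\<^esub> x)"
    and lcE: "\<And>U. openin TE U \<Longrightarrow> \<zero>\<^bsub>E\<^esub> \<in> U \<Longrightarrow>
        \<exists>V. openin TE V \<and> convex_subset E V \<and> \<zero>\<^bsub>E\<^esub> \<in> V \<and> V \<subseteq> U"
    using E by (auto simp: locally_convex_space_def)
  have c1: "continuous_map (prod_topology T' T') T' (\<lambda>(x, y). x \<oplus>\<^bsub>?E\<^esub> y)"
  proof -
    have "continuous_map (prod_topology T' T') (prod_topology TE TE)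
            (\<lambda>p. (inv_into S j (fst p), inv_into S j (snd p)))"
      using continuous_map_compose[OF continuous_map_fst cont, of T']
        continuous_map_compose[OF continuous_map_snd cont, of T']
      by (simp add: continuous_map_paired o_def)
    from continuous_map_compose[OF this addE]
    have "continuous_map (prod_topology T' T') TE
            (\<lambda>p. inv_into S j (fst p) \<oplus>\<^bsub>E\<^esub> inv_into S j (snd p))"
      by (simp add: o_def)
    moreover have "(\<lambda>p. inv_into S j (fst p) \<oplus>\<^bsub>E\<^esub> inv_into S j (snd p)) ` topspace (prod_topology T' T') \<subseteq> S"
      using Sadd by (auto simp: top')
    ultimately have "continuous_map (prod_topology T' T') T' (\<lambda>p. j (inv_into S j (fst p) \<oplus>\<^bsub>E\<^esub> inv_into S j (snd p)))"
      by (rule into)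
    then show ?thesis by (simp add: relabel_def case_prod_unfold)
  qed
  have c2: "continuous_map (prod_topology (top_of_set F) T') T' (\<lambda>(a, x). a \<odot>\<^bsub>?E\<^esub> x)"
  proof -
    have "continuous_map (prod_topology (top_of_set F) T') (prod_topology (top_of_set F) TE)
            (\<lambda>p. (fst p, inv_into S j (snd p)))"
      using continuous_map_fst[of "top_of_set F" T']
        continuous_map_compose[OF continuous_map_snd cont, of "top_of_set F"]
      by (simp add: continuous_map_paired o_def)
    from continuous_map_compose[OF this smE]
    have "continuous_map (prod_topology (top_of_set F) T') TE
            (\<lambda>p. fst p \<odot>\<^bsub>E\<^esub> inv_into S j (snd p))"
      by (simp add: o_def)
    moreover have "(\<lambda>p. fst p \<odot>\<^bsub>E\<^esub> inv_into S j (snd p)) ` topspace (prod_topology (top_of_set F) T') \<subseteq> S"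
      using Ssm by (auto simp: top')
    ultimately have "continuous_map (prod_topology (top_of_set F) T') T' (\<lambda>p. j (fst p \<odot>\<^bsub>E\<^esub> inv_into S j (snd p)))"
      by (rule into)
    then show ?thesis by (simp add: relabel_def case_prod_unfold)
  qed
  have "\<exists>V. openin T' V \<and> convex_subset ?E V \<and> \<zero>\<^bsub>?E\<^esub> \<in> V \<and> V \<subseteq> U"
    if U: "openin T' U" "\<zero>\<^bsub>?E\<^esub> \<in> U" for U
  proof -
    obtain W where W: "openin TE W" "U = inv_into S j -` W \<inter> j ` S"
      using U by (auto simp: T'_def openin_pullback_topology)
    have "\<zero>\<^bsub>E\<^esub> \<in> W" using U W S0 by (auto simp: relabel_def)
    then obtain V where V: "openin TE V" "convex_subset E V" "\<zero>\<^bsub>E\<^esub> \<in> V" "V \<subseteq> W"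
      using lcE[OF W(1)] by blast
    have "convex_subset ?E (inv_into S j -` V \<inter> j ` S)"
      using V(2) Sadd Ssm[OF tF] unfolding convex_subset_def by (auto simp: relabel_def
          simp del: of_real_diff)
    then show ?thesis
      using V W S0 by (intro exI[of _ "inv_into S j -` V \<inter> j ` S"])
        (auto simp: T'_def openin_pullback_topology relabel_def)
  qed
  then show "locally_convex_space F ?E T'"
    unfolding locally_convex_space_def using mod haus c1 c2 by (auto simp: top' relabel_def)
qed

lemma linear_operator_relabel:
  assumes "inj_on j S" and "linear_operator F A E g" and "g ` carrier A \<subseteq> S"
  shows "linear_operator F A (relabel j S E) (\<lambda>x. j (g x))"
proof -
  have "inv_into S j (j (g x)) = g x" if "x \<in> carrier A" for x
    using assms that by auto
  then show ?thesis
    using assms unfolding linear_operator_def relabel_def by auto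
qed

lemma linear_operator_compose:
  assumes "linear_operator F A B g" and "linear_operator F B C h"
  shows "linear_operator F A C (\<lambda>x. h (g x))"
  using assms unfolding linear_operator_def Pi_iff by auto

lemma linear_operator_restrict:
  assumes "Module.module (scalar_field F) A" and "linear_operator F A B g"
  shows "linear_operator F A B (restrict g (carrier A))"
proof -
  interpret A: Module.module "scalar_field F" A by fact
  show ?thesis
    using assms(2) A.smult_closed unfolding linear_operator_def Pi_iff
    by (simp add: scalar_field_def)
qed

lemma free_lcs_generated:
  fixes L :: "(complex, 'v) module" and X :: "'x topology"
  assumes F: "F = \<real> \<or> F = UNIV" and L: "free_locally_convex_space F X L T i"
    and S: "linear_subspace F L S" and iS: "i ` topspace X \<subseteq> S"
  shows "S = carrier L"
proof -
  let ?j = "Inl :: 'v \<Rightarrow> 'v + ('x \<Rightarrow> complex)"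
  let ?ES = "relabel ?j S L" and ?EL = "relabel ?j (carrier L) L"
  let ?TS = "pullback_topology (?j ` S) (inv_into S ?j) T"
    and ?TL = "pullback_topology (?j ` carrier L) (inv_into (carrier L) ?j) T"
  have lcL: "locally_convex_space F L T" and ci: "continuous_map X T i"
    and univ: "free_universal_property TYPE('v + ('x \<Rightarrow> complex)) F X L T i"
    using L by (auto simp: free_locally_convex_space_def)
  interpret L: Module.module "scalar_field F" L
    using lcL by (simp add: locally_convex_space_def)
  have top: "topspace T = carrier L" using lcL by (simp add: locally_convex_space_def)
  have SL: "S \<subseteq> carrier L" using S by (simp add: linear_subspace_def)
  have whole: "linear_subspace F L (carrier L)"
    using L.smult_closed by (auto simp: linear_subspace_def scalar_field_def)
  have inj: "inj_on ?j A" for A by auto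
  note RS = relabel_lcs[OF F lcL S inj] and RL = relabel_lcs[OF F lcL whole inj]
  obtain r where r: "linear_operator F L ?ES r" "continuous_map T ?TS r"
    "\<And>x. x \<in> topspace X \<Longrightarrow> r (i x) = ?j (i x)"
    using univ[unfolded free_universal_property_def, rule_format, OF conjI,
        OF RS(1) continuous_map_relabel[OF inj ci iS]] by blast
  define q where "q = (\<lambda>x. inv_into S ?j (r x))"
  have q: "linear_operator F L L q" "continuous_map T T q"
    using linear_operator_compose[OF r(1) RS(2)] continuous_map_compose[OF r(2) RS(3)]
    by (auto simp: q_def o_def)
  have rS: "r x \<in> ?j ` S" if "x \<in> carrier L" for x
    using r(1) that by (auto simp: linear_operator_def relabel_def)
  then have qS: "q x \<in> S" if "x \<in> carrier L" for x
    using that by (auto simp: q_def inv_into_into)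
  have qi: "q (i x) = i x" if "x \<in> topspace X" for x
    using r(3)[OF that] that iS by (auto simp: q_def)
  let ?P = "\<lambda>g. g \<in> extensional (carrier L) \<and> linear_operator F L ?EL g \<and>
              continuous_map T ?TL g \<and> (\<forall>x\<in>topspace X. g (i x) = ?j (i x))"
  have iL: "i x \<in> carrier L" if "x \<in> topspace X" for x using that iS SL by auto
  have ex1: "\<exists>!g. ?P g"
    using univ[unfolded free_universal_property_def, rule_format, OF conjI,
        OF RL(1) continuous_map_relabel[OF inj ci]] iL by blast
  have id: "linear_operator F L L (\<lambda>x. x)" by (simp add: linear_operator_def)
  have P: "?P (restrict (\<lambda>x. ?j (h x)) (carrier L))"
    if h: "linear_operator F L L h" "continuous_map T T h"
      and hi: "\<And>x. x \<in> topspace X \<Longrightarrow> h (i x) = i x" for h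
  proof (intro conjI)
    have hL: "h ` carrier L \<subseteq> carrier L" using h(1) by (auto simp: linear_operator_def)
    show "linear_operator F L ?EL (restrict (\<lambda>x. ?j (h x)) (carrier L))"
      by (intro linear_operator_restrict linear_operator_relabel inj h hL L.module_axioms)
        (use lcL in \<open>simp add: locally_convex_space_def\<close>)?
    show "continuous_map T ?TL (restrict (\<lambda>x. ?j (h x)) (carrier L))"
      by (rule continuous_map_eq[OF continuous_map_relabel[OF inj h(2)]])
        (use hL top in auto)
  qed (use hi iL in auto)
  have "restrict (\<lambda>x. ?j (q x)) (carrier L) = restrict (\<lambda>x. ?j x) (carrier L)"
    using ex1 P[OF q qi] P[OF id] by (metis (no_types, lifting) continuous_map_id id_def eq_id_iff)
  then have "q x = x" if "x \<in> carrier L" for x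
    using that by (metis restrict_apply' sum.inject(1))
  then show ?thesis using qS SL by force
qed

lemma small_subspace:
  fixes f :: "'x \<Rightarrow> 'e" and E :: "(complex, 'e) module"
  assumes F: "F = \<real> \<or> F = UNIV" and E: "Module.module (scalar_field F) E"
    and f: "f ` Y \<subseteq> carrier E"
  shows "\<exists>S (j :: 'e \<Rightarrow> 'x \<Rightarrow> complex). linear_subspace F E S \<and> f ` Y \<subseteq> S \<and> inj_on j S"
proof -
  interpret E: Module.module "scalar_field F" E by fact
  have cF: "carrier (scalar_field F) = F" by (simp add: scalar_field_def)
  have sc: "a \<odot>\<^bsub>E\<^esub> x \<in> carrier E" if "a \<in> F" "x \<in> carrier E" for a x
    using E.smult_closed that by (simp add: cF)
  have fE: "f x \<in> carrier E" if "x \<in> Y" for x using that f by auto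
  have F01: "0 \<in> F" "1 \<in> F" using F by auto
  have Fadd: "a + b \<in> F" and Fmul: "a * b \<in> F" if "a \<in> F" "b \<in> F" for a b
    using F that by auto
  define C where "C = {c :: 'x \<Rightarrow> complex. finite {x. c x \<noteq> 0} \<and> {x. c x \<noteq> 0} \<subseteq> Y \<and> range c \<subseteq> F}"
  define \<phi> where "\<phi> c = finsum E (\<lambda>x. c x \<odot>\<^bsub>E\<^esub> f x) {x. c x \<noteq> 0}" for c
  have \<phi>: "\<phi> c = finsum E (\<lambda>x. c x \<odot>\<^bsub>E\<^esub> f x) B"
    if "c \<in> C" "finite B" "{x. c x \<noteq> 0} \<subseteq> B" "B \<subseteq> Y" for c B
    unfolding \<phi>_def
  proof (rule E.add.finprod_mono_neutral_cong_left)
    fix x assume "x \<in> B - {x. c x \<noteq> 0}"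
    then show "c x \<odot>\<^bsub>E\<^esub> f x = \<zero>\<^bsub>E\<^esub>"
      using that fE E.smult_l_null by (auto simp: scalar_field_def)
  next
    show "(\<lambda>x. c x \<odot>\<^bsub>E\<^esub> f x) \<in> B \<rightarrow> carrier E"
      using that fE sc unfolding C_def by blast
  qed (use that in auto)
  have add: "\<phi> c \<oplus>\<^bsub>E\<^esub> \<phi> d = \<phi> (\<lambda>x. c x + d x) \<and> (\<lambda>x. c x + d x) \<in> C"
    if cd: "c \<in> C" "d \<in> C" for c d
  proof -
    let ?B = "{x. c x \<noteq> 0} \<union> {x. d x \<noteq> 0}"
    have B: "finite ?B" "?B \<subseteq> Y" and cF: "c x \<in> F" "d x \<in> F" for x
      using cd by (auto simp: C_def)
    have e: "(\<lambda>x. c x + d x) \<in> C"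
    proof -
      have "{x. c x + d x \<noteq> 0} \<subseteq> ?B" by auto
      then show ?thesis
        using B cF Fadd finite_subset[OF _ B(1)] unfolding C_def by blast
    qed
    have "\<phi> (\<lambda>x. c x + d x) = finsum E (\<lambda>x. (c x + d x) \<odot>\<^bsub>E\<^esub> f x) ?B"
      by (rule \<phi>[OF e B(1) _ B(2)]) auto
    also have "\<dots> = finsum E (\<lambda>x. c x \<odot>\<^bsub>E\<^esub> f x \<oplus>\<^bsub>E\<^esub> d x \<odot>\<^bsub>E\<^esub> f x) ?B"
    proof (rule E.add.finprod_cong')
      fix x assume "x \<in> ?B"
      then have "f x \<in> carrier E" using B(2) fE by blast
      then show "(c x + d x) \<odot>\<^bsub>E\<^esub> f x = c x \<odot>\<^bsub>E\<^esub> f x \<oplus>\<^bsub>E\<^esub> d x \<odot>\<^bsub>E\<^esub> f x"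
        using E.smult_l_distr[of "c x" "d x" "f x"] cF by (simp add: scalar_field_def)
    qed (use B fE sc cF in \<open>auto simp: subset_iff\<close>)
    also have "\<dots> = finsum E (\<lambda>x. c x \<odot>\<^bsub>E\<^esub> f x) ?B \<oplus>\<^bsub>E\<^esub> finsum E (\<lambda>x. d x \<odot>\<^bsub>E\<^esub> f x) ?B"
      by (rule E.finsum_addf) (use B fE sc cF in \<open>auto simp: subset_iff\<close>)
    also have "\<dots> = \<phi> c \<oplus>\<^bsub>E\<^esub> \<phi> d"
      using \<phi>[OF cd(1) B(1) _ B(2)] \<phi>[OF cd(2) B(1) _ B(2)] by simp
    finally show ?thesis using e by simp
  qed
  have smult: "a \<odot>\<^bsub>E\<^esub> \<phi> c = \<phi> (\<lambda>x. a * c x) \<and> (\<lambda>x. a * c x) \<in> C"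
    if c: "c \<in> C" and a: "a \<in> F" for a c
  proof -
    let ?B = "{x. c x \<noteq> 0}"
    have B: "finite ?B" "?B \<subseteq> Y" and cF': "c x \<in> F" for x
      using c by (auto simp: C_def)
    have e: "(\<lambda>x. a * c x) \<in> C"
    proof -
      have "{x. a * c x \<noteq> 0} \<subseteq> ?B" by auto
      then show ?thesis
        using B cF' Fmul a finite_subset[OF _ B(1)] unfolding C_def by blast
    qed
    have "\<phi> (\<lambda>x. a * c x) = finsum E (\<lambda>x. (a * c x) \<odot>\<^bsub>E\<^esub> f x) ?B"
      by (rule \<phi>[OF e B(1) _ B(2)]) auto
    also have "\<dots> = finsum E (\<lambda>x. a \<odot>\<^bsub>E\<^esub> (c x \<odot>\<^bsub>E\<^esub> f x)) ?B"
    proof (rule E.add.finprod_cong')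
      fix x assume "x \<in> ?B"
      then have "f x \<in> carrier E" using B(2) fE by blast
      then show "(a * c x) \<odot>\<^bsub>E\<^esub> f x = a \<odot>\<^bsub>E\<^esub> (c x \<odot>\<^bsub>E\<^esub> f x)"
        using E.smult_assoc1[of a "c x" "f x"] cF' a by (simp add: scalar_field_def)
    qed (use B fE sc cF' a in \<open>auto simp: subset_iff\<close>)
    also have "\<dots> = a \<odot>\<^bsub>E\<^esub> \<phi> c"
      unfolding \<phi>_def
      by (rule E.finsum_smult_ldistr[symmetric]) (use B fE sc cF' a in \<open>auto simp: subset_iff cF\<close>)
    finally show ?thesis using e by simp
  qed
  have zero: "\<zero>\<^bsub>E\<^esub> = \<phi> (\<lambda>x. 0)" "(\<lambda>x. 0) \<in> C"
    using F01 by (auto simp: \<phi>_def C_def)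
  have unit: "f y = \<phi> (\<lambda>x. if x = y then 1 else 0) \<and> (\<lambda>x. if x = y then 1 else 0) \<in> C"
    if "y \<in> Y" for y
  proof -
    have "{x. (if x = y then 1 else 0) \<noteq> (0::complex)} = {y}" by auto
    then show ?thesis
      using that fE[OF that] F01 E.smult_one[OF fE[OF that]]
      by (auto simp: \<phi>_def C_def scalar_field_def)
  qed
  have closed: "\<phi> c \<in> carrier E" if "c \<in> C" for c
    unfolding \<phi>_def by (rule E.finsum_closed) (use that fE sc in \<open>unfold C_def, blast\<close>)
  have "linear_subspace F E (\<phi> ` C)"
    unfolding linear_subspace_def using closed zero add smult by auto
  moreover have "f ` Y \<subseteq> \<phi> ` C" using unit by blast
  moreover have "inj_on (inv_into C \<phi>) (\<phi> ` C)" by (rule inj_on_inv_into) simp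
  ultimately show ?thesis by blast
qed

theorem free_lcs_universal:
  fixes L :: "(complex, 'v) module" and X :: "'x topology"
  assumes F: "F = \<real> \<or> F = UNIV" and L: "free_locally_convex_space F X L T i"
  shows "free_universal_property TYPE('e) F X L T i"
  unfolding free_universal_property_def
proof (intro allI impI, elim conjE)
  fix E :: "(complex, 'e) module" and TE f
  assume E: "locally_convex_space F E TE" and f: "continuous_map X TE f"
  have lcL: "locally_convex_space F L T" and ci: "continuous_map X T i"
    and univ: "free_universal_property TYPE('v + ('x \<Rightarrow> complex)) F X L T i"
    using L by (auto simp: free_locally_convex_space_def)
  interpret L: Module.module "scalar_field F" L
    using lcL by (simp add: locally_convex_space_def)
  interpret E: Module.module "scalar_field F" E
    using E by (simp add: locally_convex_space_def)
  have top: "topspace T = carrier L" "topspace TE = carrier E"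
    using lcL E by (simp_all add: locally_convex_space_def)
  have iL: "i x \<in> carrier L" and fE: "f x \<in> carrier E" if "x \<in> topspace X" for x
    using that ci f top by (auto simp: continuous_map_def)
  have modL: "Module.module (scalar_field F) L" and modE: "Module.module (scalar_field F) E"
    using lcL E by (simp_all add: locally_convex_space_def)
  obtain S and j0 :: "'e \<Rightarrow> 'x \<Rightarrow> complex"
    where S: "linear_subspace F E S" "f ` topspace X \<subseteq> S" and j0: "inj_on j0 S"
    using small_subspace[OF F modE, of f "topspace X"] fE by blast
  define j :: "'e \<Rightarrow> 'v + ('x \<Rightarrow> complex)" where "j = (\<lambda>x. Inr (j0 x))"
  have j: "inj_on j S" using j0 by (auto simp: j_def inj_on_def)
  note R = relabel_lcs[OF F E S(1) j]
  obtain r where r: "linear_operator F L (relabel j S E) r"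
    "continuous_map T (pullback_topology (j ` S) (inv_into S j) TE) r"
    "\<And>x. x \<in> topspace X \<Longrightarrow> r (i x) = j (f x)"
    using univ[unfolded free_universal_property_def, rule_format, OF conjI,
        OF R(1) continuous_map_relabel[OF j f S(2)]] by blast
  show "\<exists>!g. g \<in> extensional (carrier L) \<and> linear_operator F L E g \<and> continuous_map T TE g \<and>
          (\<forall>x\<in>topspace X. g (i x) = f x)"
  proof (rule ex_ex1I)
    let ?g = "restrict (\<lambda>x. inv_into S j (r x)) (carrier L)"
    have "linear_operator F L E ?g"
      by (intro linear_operator_restrict modL linear_operator_compose[OF r(1) R(2)])
    moreover have "continuous_map T TE ?g"
      by (rule continuous_map_eq[OF continuous_map_compose[OF r(2) R(3)]]) (auto simp: top)
    moreover have "\<forall>x\<in>topspace X. ?g (i x) = f x"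
      using r(3) iL S(2) j by (auto simp: inv_into_f_f)
    ultimately show "\<exists>g. g \<in> extensional (carrier L) \<and> linear_operator F L E g \<and>
        continuous_map T TE g \<and> (\<forall>x\<in>topspace X. g (i x) = f x)"
      by (intro exI[of _ ?g]) auto
  next
    fix g h
    assume "g \<in> extensional (carrier L) \<and> linear_operator F L E g \<and> continuous_map T TE g \<and>
        (\<forall>x\<in>topspace X. g (i x) = f x)"
      and "h \<in> extensional (carrier L) \<and> linear_operator F L E h \<and> continuous_map T TE h \<and>
        (\<forall>x\<in>topspace X. h (i x) = f x)"
    then have g: "g \<in> extensional (carrier L)" "linear_operator F L E g"
        "\<And>x. x \<in> topspace X \<Longrightarrow> g (i x) = f x"
      and h: "h \<in> extensional (carrier L)" "linear_operator F L E h"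
        "\<And>x. x \<in> topspace X \<Longrightarrow> h (i x) = f x"
      by auto
    have "0 \<in> F" using F by auto
    have zero: "k \<zero>\<^bsub>L\<^esub> = \<zero>\<^bsub>E\<^esub>" if k: "linear_operator F L E k" for k
    proof -
      have kz: "k \<zero>\<^bsub>L\<^esub> \<in> carrier E" using k by (auto simp: linear_operator_def)
      have "k (0 \<odot>\<^bsub>L\<^esub> \<zero>\<^bsub>L\<^esub>) = 0 \<odot>\<^bsub>E\<^esub> k \<zero>\<^bsub>L\<^esub>"
        using k \<open>0 \<in> F\<close> by (auto simp: linear_operator_def)
      then show ?thesis
        using E.smult_l_null[OF kz] L.smult_l_null[OF L.zero_closed]
        by (simp add: scalar_field_def)
    qed
    have sc: "a \<odot>\<^bsub>L\<^esub> x \<in> carrier L" if "a \<in> F" "x \<in> carrier L" for a x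
      using L.smult_closed that by (simp add: scalar_field_def)
    have "linear_subspace F L {x \<in> carrier L. g x = h x}"
      using g(2) h(2) zero[OF g(2)] zero[OF h(2)] sc
      by (auto simp: linear_subspace_def linear_operator_def)
    then have "{x \<in> carrier L. g x = h x} = carrier L"
      by (rule free_lcs_generated[OF F L]) (use g h iL in auto)
    then show "g = h"
      using g(1) h(1) by (intro extensionalityI[of g "carrier L" h]) auto
  qed
qed

end

theory Submission
  imports Defs
begin

text \<open>
  If \<open>X\<close> is finite, every vector of \<open>L(X)\<close> is the combination of the points of \<open>X\<close> whose
  coefficients are continuous functionals of it, and sequences can be chosen coordinatewise.

  If \<open>X\<close> is infinite, take disjointly supported bumps \<open>b j\<close> of height \<open>1\<close> and extend them to
  functionals \<open>\<delta> j\<close> on \<open>L(X)\<close>. In a \<open>\<kappa>\<close>-Frechet--Urysohn space an increasing sequence of closed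
  sets, none of which is a neighbourhood of \<open>0\<close>, cannot be such that every null sequence is
  contained in one of them. A gliding hump shows that every null sequence lies in some
  \<open>A n = {u. \<forall>j. \<bar>\<delta> j u\<bar> \<le> n}\<close>: otherwise some \<open>\<Sum>m. c m * b (J m)\<close> with \<open>c m \<rightarrow> 0\<close> would
  extend to a functional that does not tend to \<open>0\<close> along the sequence. Hence some \<open>A n\<close> is a
  neighbourhood of \<open>0\<close>, which makes the truncated bumps \<open>max 0 (2 * b j - 1)\<close> locally finite.
  All their linear combinations are then continuous, and the same argument applied to the
  sets of vectors annihilated by all but the first \<open>n\<close> extended functionals gives a contradiction.
\<close>

section \<open>Gliding humps and disjoint bump functions\<close>

text \<open>The pairs \<open>(K m, J m)\<close> are chosen recursively. \<open>J m\<close> lies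
  beyond the finite supports of the rows already chosen, and \<open>K m\<close> lies so far out that
  the finitely many null columns already chosen contribute at most 1. With weights
  \<open>2 / d (K l) (J l)\<close>, row \<open>K m\<close> then sums to 2 from its own column if
  that entry is nonzero, at most 1 in norm from earlier columns, and 0 from later ones.\<close>

lemma gliding_hump:
  fixes d :: "nat \<Rightarrow> nat \<Rightarrow> complex"
  assumes rows: "\<And>k. finite {j. d k j \<noteq> 0}"
    and cols: "\<And>j. (\<lambda>k. d k j) \<longlonglongrightarrow> 0"
    and P: "\<And>m n. \<exists>k\<ge>n. \<exists>j\<ge>n. P m k j"
  obtains K J :: "nat \<Rightarrow> nat" where "strict_mono K" "strict_mono J"
    "\<And>m. P m (K m) (J m)" "\<And>l m. l < m \<Longrightarrow> d (K l) (J m) = 0"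
    "\<And>m. norm (\<Sum>l<m. 2 / d (K l) (J l) * d (K m) (J l)) \<le> 1"
proof -
  define R where "R f m r \<longleftrightarrow> P m (fst r) (snd r) \<and>
      (\<forall>l<m. fst (f l) < fst r \<and> snd (f l) < snd r \<and> d (fst (f l)) (snd r) = 0) \<and>
      norm (\<Sum>l<m. 2 / d (fst (f l)) (snd (f l)) * d (fst r) (snd (f l))) \<le> 1"
    for f :: "nat \<Rightarrow> nat \<times> nat" and m r
  have "\<exists>f. \<forall>m. R f m (f m)"
  proof (rule dependent_wellorder_choice)
    fix r and f g :: "nat \<Rightarrow> nat \<times> nat" and m
    assume "\<And>l. l < m \<Longrightarrow> f l = g l"
    then show "R f m r = R g m r" by (simp add: R_def)
  next
    fix m and f :: "nat \<Rightarrow> nat \<times> nat"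
    have "(\<lambda>k. \<Sum>l<m. 2 / d (fst (f l)) (snd (f l)) * d k (snd (f l))) \<longlonglongrightarrow>
        (\<Sum>l<m. 2 / d (fst (f l)) (snd (f l)) * 0)"
      by (intro tendsto_sum tendsto_mult tendsto_const cols)
    then have "\<forall>\<^sub>F k in sequentially. norm (\<Sum>l<m. 2 / d (fst (f l)) (snd (f l)) * d k (snd (f l))) < 1"
      by (intro order_tendstoD(2)[OF tendsto_norm]) auto
    then obtain N where N: "\<And>k. k \<ge> N \<Longrightarrow> norm (\<Sum>l<m. 2 / d (fst (f l)) (snd (f l)) * d k (snd (f l))) < 1"
      unfolding eventually_sequentially by blast
    \<comment> \<open>All indices that the new pair has to exceed: the earlier row and column
      indices and the supports of the earlier rows.\<close>
    let ?S = "\<Union>l<m. {fst (f l), snd (f l)} \<union> {j. d (fst (f l)) j \<noteq> 0}"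
    have "finite ?S" using rows by auto
    then obtain M where M: "\<And>x. x \<in> ?S \<Longrightarrow> x < M"
      using finite_nat_set_iff_bounded by meson
    obtain k j where kj: "k \<ge> max N M" "j \<ge> max N M" "P m k j" using P by blast
    have "fst (f l) < k \<and> snd (f l) < j \<and> d (fst (f l)) j = 0" if "l < m" for l
    proof -
      have "fst (f l) < M" "snd (f l) < M"
        by (rule M, use that in auto)+
      moreover have "d (fst (f l)) j = 0"
      proof (rule ccontr)
        assume "d (fst (f l)) j \<noteq> 0"
        then have "j < M" by (intro M) (use that in auto)
        then show False using kj by simp
      qed
      ultimately show ?thesis using kj by auto
    qed
    then have "R f m (k, j)" using kj N[of k] by (auto simp: R_def intro: less_imp_le)
    then show "\<exists>r. R f m r" by blast
  qed
  then obtain f where f: "\<And>m. R f m (f m)" by blast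
  show ?thesis
  proof (rule that[of "fst \<circ> f" "snd \<circ> f"])
    show "strict_mono (fst \<circ> f)" "strict_mono (snd \<circ> f)"
      using f by (auto simp: R_def strict_mono_def)
  qed (use f in \<open>auto simp: R_def\<close>)
qed

text \<open>Two points of \<open>W\<close> are separated by open sets \<open>A\<close> and
  \<open>B\<close>. If \<open>W \<inter> B\<close> is infinite, it is the remainder and
  \<open>W \<inter> A\<close> is split off. If it is finite, it is closed, so it can be split off
  itself and \<open>W\<close> minus it is still open and infinite.\<close>

lemma infinite_Hausdorff_split:
  assumes "Hausdorff_space X" "openin X W" "infinite W"
  obtains V W' where "openin X V" "V \<noteq> {}" "openin X W'" "infinite W'" "V \<inter> W' = {}"
    "V \<subseteq> W" "W' \<subseteq> W"
proof -
  obtain x where x: "x \<in> W" using assms(3) by fastforce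
  obtain y where y: "y \<in> W" "y \<noteq> x"
    using assms(3) x by (metis finite.emptyI finite.insertI insertCI subset_eq finite_subset)
  have "x \<in> topspace X" "y \<in> topspace X"
    using openin_subset[OF assms(2)] x y by auto
  then obtain A B where AB: "openin X A" "openin X B" "x \<in> A" "y \<in> B" "disjnt A B"
    using assms(1) y(2) unfolding Hausdorff_space_def by metis
  show ?thesis
  proof (cases "finite (W \<inter> B)")
    case True
    then have "closedin X (W \<inter> B)"
      using assms(1,2) openin_subset by (intro closedin_Hausdorff_finite) auto
    then show ?thesis
      using True assms AB y by (intro that[of "W \<inter> B" "W - W \<inter> B"]) auto
  next
    case False
    then show ?thesis
      using assms AB x by (intro that[of "W \<inter> A" "W \<inter> B"]) (auto simp: disjnt_def)
  qed
qed

text \<open>Iteration of the split: each stage keeps a nonempty open set together with an infinite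
  open remainder disjoint from it, and all later sets are taken inside that remainder.\<close>

lemma infinite_Hausdorff_disjoint_open:
  assumes "Hausdorff_space X" "infinite (topspace X)"
  obtains V :: "nat \<Rightarrow> 'a set" where "\<And>n. openin X (V n)" "\<And>n. V n \<noteq> {}" "disjoint_family V"
proof -
  define Q where "Q p \<longleftrightarrow> openin X (fst p) \<and> fst p \<noteq> {} \<and> openin X (snd p) \<and> infinite (snd p) \<and>
      fst p \<inter> snd p = {}" for p :: "'a set \<times> 'a set"
  have "\<exists>f. \<forall>n. Q (f n) \<and> fst (f (Suc n)) \<subseteq> snd (f n) \<and> snd (f (Suc n)) \<subseteq> snd (f n)"
  proof (rule dependent_nat_choice)
    show "\<exists>p. Q p"
      using infinite_Hausdorff_split[OF assms(1) openin_topspace assms(2)] by (metis Q_def fst_conv snd_conv)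
  next
    fix p :: "'a set \<times> 'a set" and n :: nat assume "Q p"
    then show "\<exists>q. Q q \<and> fst q \<subseteq> snd p \<and> snd q \<subseteq> snd p"
      using infinite_Hausdorff_split[OF assms(1), of "snd p"] by (metis Q_def fst_conv snd_conv)
  qed
  then obtain f where f: "\<And>n. Q (f n)" "\<And>n. fst (f (Suc n)) \<subseteq> snd (f n)"
    "\<And>n. snd (f (Suc n)) \<subseteq> snd (f n)" by blast
  have dec: "decseq (\<lambda>n. snd (f n))" by (rule decseq_SucI) (use f in auto)
  have "fst (f m) \<inter> fst (f n) = {}" if "m < n" for m n
  proof -
    obtain k where k: "n = Suc k" "m \<le> k" using \<open>m < n\<close> by (metis less_Suc_eq_le less_imp_Suc_add le_add1)
    then have "fst (f n) \<subseteq> snd (f m)" using f(2)[of k] dec by (auto simp: decseq_def)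
    then show ?thesis using f(1)[of m] by (auto simp: Q_def)
  qed
  then have "disjoint_family (\<lambda>n. fst (f n))"
    unfolding disjoint_family_on_def by (metis inf_commute linorder_neqE_nat)
  then show ?thesis using f(1) by (intro that[of "\<lambda>n. fst (f n)"]) (auto simp: Q_def)
qed

lemma disjoint_bumps:
  assumes "completely_regular_space X" "Hausdorff_space X" "infinite (topspace X)"
  obtains f :: "nat \<Rightarrow> 'a \<Rightarrow> real" and p :: "nat \<Rightarrow> 'a" where
    "\<And>n. continuous_map X euclideanreal (f n)" "\<And>n x. 0 \<le> f n x" "\<And>n x. f n x \<le> 1"
    "\<And>n. p n \<in> topspace X" "\<And>n. f n (p n) = 1"
    "\<And>m n x. x \<in> topspace X \<Longrightarrow> f m x \<noteq> 0 \<Longrightarrow> f n x \<noteq> 0 \<Longrightarrow> m = n"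
proof -
  obtain V :: "nat \<Rightarrow> 'a set" where V: "\<And>n. openin X (V n)" "\<And>n. V n \<noteq> {}" "disjoint_family V"
    using infinite_Hausdorff_disjoint_open[OF assms(2,3)] by blast
  then have "\<forall>n. \<exists>x. x \<in> V n" by blast
  then obtain p where p: "\<And>n. p n \<in> V n" by metis
  have "\<exists>g. continuous_map X euclideanreal g \<and> g (p n) = 0 \<and> g ` (topspace X - V n) \<subseteq> {1}" for n
    using assms(1) V(1) p unfolding completely_regular_space_alt' by blast
  then obtain g where g: "\<And>n. continuous_map X euclideanreal (g n)" "\<And>n. g n (p n) = 0"
    "\<And>n. g n ` (topspace X - V n) \<subseteq> {1}" by metis
  \<comment> \<open>Complete regularity gives 0 at the point and 1 off \<open>V n\<close>. The
    values are reversed and then clipped to the unit interval.\<close>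
  define f where "f n x = max 0 (min 1 (1 - g n x))" for n x
  have 0: "x \<in> V n" if "x \<in> topspace X" "f n x \<noteq> 0" for n x
    using g(3)[of n] that by (auto simp: f_def)
  show ?thesis
  proof (rule that[of f p])
    show "continuous_map X euclideanreal (f n)" for n
      unfolding f_def by (intro continuous_intros g(1))
    show "p n \<in> topspace X" for n using p openin_subset[OF V(1)] by blast
    show "m = n" if "x \<in> topspace X" "f m x \<noteq> 0" "f n x \<noteq> 0" for m n x
      using 0[OF that(1,2)] 0[OF that(1,3)] V(3) unfolding disjoint_family_on_def by blast
  qed (use g(2) in \<open>auto simp: f_def\<close>)
qed

text \<open>An \<open>e / 3\<close> argument. The approximant may depend on the point and on
  \<open>e\<close>; for a series of functions it will be a partial sum.\<close>

lemma continuous_map_locally_approximable: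
  fixes h :: "'a \<Rightarrow> complex"
  assumes "\<And>x e. x \<in> topspace X \<Longrightarrow> 0 < e \<Longrightarrow>
    \<exists>N g. openin X N \<and> x \<in> N \<and> continuous_map X euclidean g \<and> (\<forall>y\<in>N. norm (h y - g y) < e)"
  shows "continuous_map X euclidean h"
proof (unfold continuous_map_atin, intro ballI)
  fix x assume x: "x \<in> topspace X"
  have "(h \<longlongrightarrow> h x) (atin X x)"
  proof (rule tendstoI)
    fix e :: real assume "0 < e"
    then obtain N g where N: "openin X N" "x \<in> N" "continuous_map X euclidean g"
      "\<And>y. y \<in> N \<Longrightarrow> norm (h y - g y) < e / 3"
      using assms[OF x, of "e / 3"] by auto
    have "(g \<longlongrightarrow> g x) (atin X x)"
      using N(3) x by (simp add: continuous_map_atin)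
    then have "\<forall>\<^sub>F y in atin X x. dist (g y) (g x) < e / 3"
      using \<open>0 < e\<close> by (intro tendstoD) auto
    moreover have "\<forall>\<^sub>F y in atin X x. y \<in> N"
      using N x by (auto simp: eventually_atin)
    ultimately show "\<forall>\<^sub>F y in atin X x. dist (h y) (h x) < e"
    proof eventually_elim
      case (elim y)
      have "norm (h y - h x) \<le> norm (h y - g y) + norm (g y - g x) + norm (h x - g x)"
        by (smt (verit) norm_minus_commute norm_diff_triangle_le norm_triangle_ineq diff_add_cancel add_diff_eq)
      then show ?case using N(4)[of y] N(4)[of x] N(2) elim by (simp add: dist_norm)
    qed
  qed
  then show "limitin euclidean h (h x) (atin X x)" by simp
qed

text \<open>Evaluating a series of disjointly supported functions at a point gives such a sequence.
  Its sum is 0 or its single nonzero term, so the error of a partial sum is 0 or one term of the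
  tail. A bound on the individual tail terms thus suffices, without summing them.\<close>

lemma
  fixes a :: "nat \<Rightarrow> 'a::real_normed_vector"
  assumes "\<And>m n. a m \<noteq> 0 \<Longrightarrow> a n \<noteq> 0 \<Longrightarrow> m = n"
  shows sums_at_most_one_term: "a sums suminf a"
    and suminf_at_most_one_term: "suminf a \<in> insert 0 (range a)"
    and suminf_diff_at_most_one_term:
      "\<And>M e. 0 < e \<Longrightarrow> (\<And>m. M \<le> m \<Longrightarrow> norm (a m) < e) \<Longrightarrow> norm (suminf a - (\<Sum>m<M. a m)) < e"
proof -
  have *: "a sums suminf a \<and> suminf a \<in> insert 0 (range a) \<and>
      (\<forall>M e. 0 < e \<longrightarrow> (\<forall>m\<ge>M. norm (a m) < e) \<longrightarrow> norm (suminf a - (\<Sum>m<M. a m)) < e)"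
  proof (cases "\<exists>m. a m \<noteq> 0")
    case True
    then obtain m where "a m \<noteq> 0" by blast
    then have 0: "a n = 0" if "n \<noteq> m" for n using assms that by blast
    then have s: "a sums a m" using sums_finite[of "{m}" a] by simp
    have "(\<Sum>n<M. a n) = (if m < M then a m else 0)" for M
      using sum.delta[of "{..<M}" m a] 0 by (simp add: sum.cong[of _ _ a "\<lambda>n. if n = m then a n else 0"])
    moreover have "suminf a = a m" using sums_unique[OF s] by simp
    ultimately show ?thesis using s by (auto simp: not_less)
  next
    case False
    then have "a = (\<lambda>_. 0)" by auto
    then show ?thesis by simp
  qed
  show "a sums suminf a" "suminf a \<in> insert 0 (range a)"
    "\<And>M e. 0 < e \<Longrightarrow> (\<And>m. M \<le> m \<Longrightarrow> norm (a m) < e) \<Longrightarrow> norm (suminf a - (\<Sum>m<M. a m)) < e"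
    using * by blast+
qed

section \<open>Limits in locally convex spaces\<close>

locale lcs =
  fixes F :: "complex set" and E :: "(complex, 'v, 'm) module_scheme" (structure)
    and T :: "'v topology"
  assumes F: "F = \<real> \<or> F = UNIV" and locally_convex: "locally_convex_space F E T"
begin

sublocale Module.module "scalar_field F" E
  using locally_convex by (simp add: locally_convex_space_def)

lemma topspace_T: "topspace T = carrier E"
  using locally_convex by (simp add: locally_convex_space_def)

lemma scalar_simps [simp]:
  "carrier (scalar_field F) = F" "\<one>\<^bsub>scalar_field F\<^esub> = 1" "\<zero>\<^bsub>scalar_field F\<^esub> = 0"
  "a \<oplus>\<^bsub>scalar_field F\<^esub> b = a + b" "a \<otimes>\<^bsub>scalar_field F\<^esub> b = a * b"
  by (simp_all add: scalar_field_def)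

lemma smult_1 [simp]: "x \<in> carrier E \<Longrightarrow> 1 \<odot> x = x"
  using smult_one by simp

lemma smult_0 [simp]: "x \<in> carrier E \<Longrightarrow> 0 \<odot> x = \<zero>"
  using smult_l_null by simp

lemma scalar_closed:
  "0 \<in> F" "1 \<in> F" "complex_of_real t \<in> F" "a \<in> F \<Longrightarrow> b \<in> F \<Longrightarrow> a + b \<in> F"
  "a \<in> F \<Longrightarrow> b \<in> F \<Longrightarrow> a * b \<in> F" "a \<in> F \<Longrightarrow> - a \<in> F" "a \<in> F \<Longrightarrow> b \<in> F \<Longrightarrow> a / b \<in> F"
  using F by auto

lemma smult_cancel:
  assumes "a \<in> F" "a \<noteq> 0" "x \<in> carrier E" "a \<odot> x = \<zero>"
  shows "x = \<zero>"
proof -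
  have a: "1 / a \<in> F"
    by (intro scalar_closed assms)
  have "(1 / a) \<odot> (a \<odot> x) = x"
    using smult_assoc1[OF _ _ assms(3), of "1 / a" a] assms a by simp
  then show ?thesis
    using assms smult_r_null[of "1 / a"] a by simp
qed

lemma limitin_add:
  assumes "limitin T u x G" "limitin T v y G"
  shows "limitin T (\<lambda>k. u k \<oplus> v k) (x \<oplus> y) G"
proof -
  have c: "continuous_map (prod_topology T T) T (\<lambda>(x, y). x \<oplus> y)"
    using locally_convex by (simp add: locally_convex_space_def)
  have "limitin (prod_topology T T) (\<lambda>k. (u k, v k)) (x, y) G"
    using assms by (simp add: limitin_pairwise o_def)
  from continuous_map_limit[OF c this] show ?thesis
    by (simp add: o_def)
qed

lemma limitin_smult:
  assumes "(a \<longlongrightarrow> b) G" "range a \<subseteq> F" "b \<in> F" "limitin T u x G"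
  shows "limitin T (\<lambda>k. a k \<odot> u k) (b \<odot> x) G"
proof -
  have c: "continuous_map (prod_topology (top_of_set F) T) T (\<lambda>(a, x). a \<odot> x)"
    using locally_convex by (simp add: locally_convex_space_def)
  have "limitin (prod_topology (top_of_set F) T) (\<lambda>k. (a k, u k)) (b, x) G"
    using assms by (auto simp add: limitin_pairwise o_def limitin_subtopology intro!: always_eventually)
  from continuous_map_limit[OF c this] show ?thesis
    by (simp add: o_def)
qed

lemma continuous_map_add:
  assumes "continuous_map Y T u" "continuous_map Y T v"
  shows "continuous_map Y T (\<lambda>k. u k \<oplus> v k)"
proof -
  have c: "continuous_map (prod_topology T T) T (\<lambda>(x, y). x \<oplus> y)"
    using locally_convex by (simp add: locally_convex_space_def)
  have "continuous_map Y (prod_topology T T) (\<lambda>k. (u k, v k))"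
    using assms by (simp add: continuous_map_paired)
  from continuous_map_compose[OF this c] show ?thesis
    by (simp add: o_def)
qed

lemma continuous_map_smult:
  assumes "a \<in> F" "continuous_map Y T u"
  shows "continuous_map Y T (\<lambda>k. a \<odot> u k)"
proof -
  have c: "continuous_map (prod_topology (top_of_set F) T) T (\<lambda>(a, x). a \<odot> x)"
    using locally_convex by (simp add: locally_convex_space_def)
  have "continuous_map Y (prod_topology (top_of_set F) T) (\<lambda>k. (a, u k))"
    using assms by (simp add: continuous_map_paired)
  from continuous_map_compose[OF this c] show ?thesis
    by (simp add: o_def)
qed

lemma minus_eq_smult: "x \<in> carrier E \<Longrightarrow> \<ominus> x = (- 1) \<odot> x"
  using smult_l_minus[of 1 x] scalar_closed smult_l_distr[of "-1" 1 x] smult_l_null[of x]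
  by (intro minus_equality) auto

lemma limitin_diff:
  assumes "limitin T u x G" "limitin T v y G" "range v \<subseteq> carrier E"
  shows "limitin T (\<lambda>k. u k \<ominus> v k) (x \<ominus> y) G"
proof -
  have y: "y \<in> carrier E" "v k \<in> carrier E" for k
    using limitin_topspace[OF assms(2)] topspace_T assms(3) by auto
  have "limitin T (\<lambda>k. (- 1) \<odot> v k) ((- 1) \<odot> y) G"
    by (rule limitin_smult) (use assms scalar_closed in auto)
  from limitin_add[OF assms(1) this] show ?thesis
    using y by (simp add: a_minus_def minus_eq_smult)
qed

text \<open>Values are complex by type but confined to \<open>F\<close> on the carrier, so for
  \<open>F = \<real>\<close> these are the real functionals.\<close>

definition continuous_functional :: "('v \<Rightarrow> complex) \<Rightarrow> bool" where
  "continuous_functional \<delta> \<longleftrightarrow> continuous_map T euclidean \<delta> \<and> \<delta> ` carrier E \<subseteq> F \<and>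
     (\<forall>x\<in>carrier E. \<forall>y\<in>carrier E. \<delta> (x \<oplus> y) = \<delta> x + \<delta> y) \<and>
     (\<forall>a\<in>F. \<forall>x\<in>carrier E. \<delta> (a \<odot> x) = a * \<delta> x)"

lemma functional_diff:
  assumes "continuous_functional \<delta>" "x \<in> carrier E" "y \<in> carrier E"
  shows "\<delta> (x \<ominus> y) = \<delta> x - \<delta> y"
  using assms scalar_closed smult_closed[of "-1" y]
  by (simp add: continuous_functional_def a_minus_def minus_eq_smult)

lemma zero_minus_zero [simp]: "\<zero> \<ominus> \<zero> = \<zero>"
  using r_neg[of \<zero>] by (simp add: a_minus_def)

lemma functional_zero:
  assumes "continuous_functional \<delta>"
  shows "\<delta> \<zero> = 0"
  using functional_diff[OF assms, of \<zero> \<zero>] by simp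

lemma functional_null_sequence:
  assumes "continuous_functional \<delta>" "limitin T v \<zero> sequentially"
  shows "(\<lambda>k. \<delta> (v k)) \<longlonglongrightarrow> 0"
  using continuous_map_limit[OF _ assms(2), of euclidean \<delta>] assms functional_zero[OF assms(1)]
  by (simp add: continuous_functional_def o_def)

lemma limitin_finsum:
  assumes "finite B" "\<And>b. b \<in> B \<Longrightarrow> limitin T (u b) (x b) G" "\<And>b. b \<in> B \<Longrightarrow> range (u b) \<subseteq> carrier E"
  shows "limitin T (\<lambda>k. finsum E (\<lambda>b. u b k) B) (finsum E x B) G"
  using assms
proof (induction B rule: finite_induct)
  case empty
  then show ?case by (simp add: topspace_T)
next
  case (insert b B)
  have x: "x c \<in> carrier E" if "c \<in> insert b B" for c
    using limitin_topspace[OF insert.prems(1)[OF that]] topspace_T by simp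
  have u: "u c k \<in> carrier E" if "c \<in> insert b B" for c k
    using insert.prems(2)[OF that] by auto
  have "limitin T (\<lambda>k. u b k \<oplus> finsum E (\<lambda>b. u b k) B) (x b \<oplus> finsum E x B) G"
    using insert by (intro limitin_add) auto
  moreover have "finsum E (\<lambda>b. u b k) (insert b B) = u b k \<oplus> finsum E (\<lambda>b. u b k) B" for k
    using insert.hyps u by (intro finsum_insert) auto
  moreover have "finsum E x (insert b B) = x b \<oplus> finsum E x B"
    using insert.hyps x by (intro finsum_insert) auto
  ultimately show ?case by simp
qed

text \<open>
  The open set witnessing the failure consists of pieces near \<open>z / (n + 1)\<close>, each bounded away
  from \<open>0\<close> and avoiding the translate of \<open>A n\<close>. A sequence in it that tends to \<open>0\<close> runs through
  infinitely many pieces.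
\<close>

lemma kappa_Frechet_Urysohn_null_sequence:
  assumes kFU: "kappa_Frechet_Urysohn_space T"
    and z: "z \<in> carrier E" "z \<noteq> \<zero>"
    and A: "\<And>n. closedin T (A n)" "incseq A"
    and nbhd: "\<And>n V. openin T V \<Longrightarrow> \<zero> \<in> V \<Longrightarrow> \<not> V \<subseteq> A n"
  obtains v :: "nat \<Rightarrow> 'v" where "range v \<subseteq> carrier E" "limitin T v \<zero> sequentially" "\<And>n. \<exists>k. v k \<notin> A n"
proof -
  define c :: "nat \<Rightarrow> complex" where "c n = of_real (inverse (real (Suc n)))" for n
  define w where "w n = c n \<odot> z" for n
  have c: "c n \<in> F" "c n \<noteq> 0" for n
    unfolding c_def by (rule scalar_closed) (simp del: of_nat_Suc)
  have c_lim: "c \<longlonglongrightarrow> 0"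
    unfolding c_def using tendsto_of_real[OF LIMSEQ_inverse_real_of_nat, where 'a = complex] by simp
  have w: "w n \<in> carrier E" "w n \<noteq> \<zero>" for n
    using smult_cancel[OF c, of z] c z by (auto simp: w_def)
  have w_lim: "limitin T w \<zero> sequentially"
    using limitin_smult[of c 0 sequentially "\<lambda>_. z" z] c_lim c(1) z(1) scalar_closed(1)
    by (simp add: w_def[abs_def] topspace_T image_subset_iff)
  have "Hausdorff_space T"
    using locally_convex by (simp add: locally_convex_space_def)
  then have "\<exists>P Q. openin T P \<and> openin T Q \<and> \<zero> \<in> P \<and> w n \<in> Q \<and> disjnt P Q" for n
    using w[of n] unfolding Hausdorff_space_def by (metis topspace_T zero_closed)
  then obtain P Q where PQ: "\<And>n. openin T (P n)" "\<And>n. openin T (Q n)" "\<And>n. \<zero> \<in> P n"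
    "\<And>n. w n \<in> Q n" "\<And>n. disjnt (P n) (Q n)"
    by metis
  have shift: "continuous_map T T (\<lambda>x. x \<ominus> w n)" "continuous_map T T (\<lambda>x. x \<oplus> w n)" for n
    using continuous_map_add[of T "\<lambda>x. x" "\<lambda>_. \<ominus> w n"] continuous_map_add[of T "\<lambda>x. x" "\<lambda>_. w n"] w
    by (simp_all add: topspace_T a_minus_def)
  define U where "U n = {x \<in> topspace T. x \<ominus> w n \<in> topspace T - A n} \<inter> Q n" for n
  have U: "openin T (U n)" for n
    unfolding U_def using A(1) PQ(2)
    by (intro openin_Int openin_continuous_map_preimage[OF shift(1)]) auto
  \<comment> \<open>A neighbourhood of \<open>w n\<close>, cut down to \<open>Q n\<close> and
    translated to the origin, is not contained in \<open>A n\<close>; translating back a point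
    outside \<open>A n\<close> gives a point of \<open>U n\<close>.\<close>
  have w_cl: "w n \<in> T closure_of U n" for n
  proof (unfold in_closure_of, intro conjI allI impI)
    show "w n \<in> topspace T" using w by (simp add: topspace_T)
    fix V assume V: "w n \<in> V \<and> openin T V"
    let ?V = "{x \<in> topspace T. x \<oplus> w n \<in> V \<inter> Q n}"
    have "openin T ?V"
      using V PQ by (intro openin_continuous_map_preimage[OF shift(2)]) auto
    moreover have "\<zero> \<in> ?V" using V PQ w by (simp add: topspace_T)
    ultimately obtain x where x: "x \<in> ?V" "x \<notin> A n" using nbhd by blast
    then have "x \<oplus> w n \<ominus> w n = x"
      using w[of n] by (simp add: topspace_T a_minus_def a_assoc r_neg)
    then show "\<exists>y. y \<in> U n \<and> y \<in> V"
      using x w[of n] by (intro exI[of _ "x \<oplus> w n"]) (simp add: U_def topspace_T)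
  qed
  have "openin T (\<Union>n. U n)" using U by blast
  moreover have "\<zero> \<in> T closure_of (\<Union>n. U n)"
  proof (unfold in_closure_of, intro conjI allI impI)
    fix V assume V: "\<zero> \<in> V \<and> openin T V"
    then obtain n where "w n \<in> V"
      using w_lim unfolding limitin_sequentially by blast
    then show "\<exists>y. y \<in> (\<Union>n. U n) \<and> y \<in> V"
      using w_cl[of n] V unfolding in_closure_of by blast
  qed (simp add: topspace_T)
  ultimately obtain u :: "nat \<Rightarrow> 'v" where u: "range u \<subseteq> (\<Union>n. U n)" "limitin T u \<zero> sequentially"
    using kFU unfolding kappa_Frechet_Urysohn_space_def by blast
  then have "\<forall>k. \<exists>n. u k \<in> U n" by blast
  then obtain N where N: "\<And>k. u k \<in> U (N k)" by metis
  have uE: "u k \<in> carrier E" for k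
    using N[of k] by (simp add: U_def topspace_T)
  \<comment> \<open>Finitely many of the sets \<open>P n\<close> have a common neighbourhood of the
    origin, and each \<open>P n\<close> misses the piece \<open>U n\<close>. A null sequence
    therefore eventually leaves any finite number of pieces.\<close>
  have N_lim: "filterlim N at_top sequentially"
  proof (unfold filterlim_at_top, intro allI)
    fix m
    have "\<forall>\<^sub>F k in sequentially. \<forall>n\<in>{..<m}. u k \<in> P n"
      using limitinD[OF u(2) PQ(1,3)] by (intro eventually_ball_finite) auto
    then show "\<forall>\<^sub>F k in sequentially. m \<le> N k"
    proof (rule eventually_mono)
      fix k assume "\<forall>n\<in>{..<m}. u k \<in> P n"
      then show "m \<le> N k"
        using N[of k] PQ(5)[of "N k"] by (force simp: U_def disjnt_def)
    qed
  qed
  \<comment> \<open>Since the piece indices tend to infinity, the shifts \<open>w (N k)\<close> tend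
    to 0. Subtracting them leaves a null sequence whose term \<open>k\<close> is outside
    \<open>A (N k)\<close>, hence outside every earlier \<open>A n\<close>.\<close>
  have "limitin T (\<lambda>k. w (N k)) \<zero> sequentially"
    using w_lim N_lim unfolding limitin_def filterlim_iff
    by blast
  then have "limitin T (\<lambda>k. u k \<ominus> w (N k)) (\<zero> \<ominus> \<zero>) sequentially"
    using u(2) w by (intro limitin_diff) auto
  then have "limitin T (\<lambda>k. u k \<ominus> w (N k)) \<zero> sequentially"
    by simp
  moreover have "\<exists>k. u k \<ominus> w (N k) \<notin> A n" for n
  proof -
    obtain k where "n \<le> N k"
      using N_lim unfolding filterlim_at_top eventually_sequentially by blast
    then have "A n \<subseteq> A (N k)" using A(2) by (auto simp: incseq_def)
    then show ?thesis using N[of k] unfolding U_def by blast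
  qed
  ultimately show ?thesis
    using uE w by (intro that[of "\<lambda>k. u k \<ominus> w (N k)"]) auto
qed

end

section \<open>Functionals on the free locally convex space\<close>

definition scalar_module :: "complex set \<Rightarrow> (complex, complex) module" where
  "scalar_module F = \<lparr>carrier = F, monoid.mult = (*), one = 1, zero = 0, add = (+), module.smult = (*)\<rparr>"

text \<open>Makes the field itself a test space for the universal property, so that scalar functions
  on \<open>X\<close> extend to functionals. Convex neighbourhoods of 0 are the balls intersected
  with \<open>F\<close>.\<close>

lemma (in lcs) locally_convex_scalar_module:
  "locally_convex_space F (scalar_module F) (top_of_set F)"
proof -
  have "abelian_group (scalar_module F)"
  proof (rule abelian_groupI)
    fix x assume "x \<in> carrier (scalar_module F)"
    then show "\<exists>y\<in>carrier (scalar_module F). y \<oplus>\<^bsub>scalar_module F\<^esub> x = \<zero>\<^bsub>scalar_module F\<^esub>"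
      by (intro bexI[of _ "- x"]) (auto simp: scalar_module_def scalar_closed)
  qed (auto simp: scalar_module_def scalar_closed)
  then have "Module.module (scalar_field F) (scalar_module F)"
    by (intro Module.moduleI R.is_cring) (auto simp: scalar_module_def scalar_closed algebra_simps)
  moreover have "Hausdorff_space (top_of_set F)"
    by (simp add: Hausdorff_space_subtopology)
  moreover have "continuous_map (prod_topology (top_of_set F) (top_of_set F)) (top_of_set F) (\<lambda>(x, y). x + y)"
    unfolding prod_topology_subtopology_eu using scalar_closed
    by (auto simp: case_prod_unfold intro!: continuous_intros)
  moreover have "continuous_map (prod_topology (top_of_set F) (top_of_set F)) (top_of_set F) (\<lambda>(x, y). x * y)"
    unfolding prod_topology_subtopology_eu using scalar_closed
    by (auto simp: case_prod_unfold intro!: continuous_intros)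
  moreover have "\<exists>V. openin (top_of_set F) V \<and> convex_subset (scalar_module F) V \<and> 0 \<in> V \<and> V \<subseteq> U"
    if U: "openin (top_of_set F) U" "0 \<in> U" for U
  proof -
    obtain e where e: "0 < e" "ball 0 e \<inter> F \<subseteq> U"
      using U unfolding openin_contains_ball by (metis)
    have "convex (ball (0::complex) e)" by simp
    have "complex_of_real t * x + complex_of_real (1 - t) * y \<in> ball 0 e \<inter> F"
      if "x \<in> ball 0 e \<inter> F" "y \<in> ball 0 e \<inter> F" "0 \<le> t" "t \<le> 1" for x y t
    proof
      show "complex_of_real t * x + complex_of_real (1 - t) * y \<in> ball 0 e"
        using convexD[OF \<open>convex (ball 0 e)\<close>, of x y t "1 - t"] that
        by (simp add: scaleR_conv_of_real)
    qed (use that in \<open>auto intro!: scalar_closed simp del: of_real_diff\<close>)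
    then have "convex_subset (scalar_module F) (ball 0 e \<inter> F)"
      by (auto simp: convex_subset_def scalar_module_def)
    then show ?thesis
      using e scalar_closed(1) by (intro exI[of _ "ball 0 e \<inter> F"]) (auto simp: openin_open)
  qed
  ultimately show ?thesis
    unfolding locally_convex_space_def by (simp add: scalar_module_def)
qed

section \<open>Extension of functions on \<open>X\<close> to functionals on \<open>L(X)\<close>, and
  reduction of linear statements to the points of \<open>X\<close>\<close>

locale free_lcs = lcs F L T
  for F and L :: "(complex, 'v) module" (structure) and T +
  fixes X :: "'x topology" and i :: "'x \<Rightarrow> 'v"
  assumes free: "free_locally_convex_space F X L T i"
begin

lemma continuous_i: "continuous_map X T i"
  using free by (simp add: free_locally_convex_space_def)

lemma i_closed: "x \<in> topspace X \<Longrightarrow> i x \<in> carrier L"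
  using continuous_map_funspace[OF continuous_i] topspace_T by auto

text \<open>The universal property with the field as target. The type of its vectors is
  \<open>complex\<close>, not the type fixed in the definition of freeness, hence the appeal to
  \<open>free_lcs_universal\<close>.\<close>

lemma extend_functional:
  assumes "continuous_map X euclidean f" "f ` topspace X \<subseteq> F"
  obtains \<delta> where "continuous_functional \<delta>" "\<And>x. x \<in> topspace X \<Longrightarrow> \<delta> (i x) = f x"
proof -
  have "continuous_map X (top_of_set F) f"
    using assms by (auto simp: continuous_map_in_subtopology)
  then obtain \<delta> where \<delta>: "linear_operator F L (scalar_module F) \<delta>"
      "continuous_map T (top_of_set F) \<delta>" "\<forall>x\<in>topspace X. \<delta> (i x) = f x"
    using free_lcs_universal[OF F free, unfolded free_universal_property_def, rule_format,
        OF conjI[OF locally_convex_scalar_module]] by blast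
  then have "continuous_functional \<delta>"
    unfolding continuous_functional_def linear_operator_def
    by (auto simp: scalar_module_def continuous_map_in_subtopology)
  then show ?thesis using that \<delta>(3) by blast
qed

text \<open>An induction principle: \<open>L(X)\<close> has no proper linear subspace containing the
  image of \<open>X\<close>, so a property that holds there and defines a subspace holds
  everywhere.\<close>

lemma generated:
  assumes "linear_subspace F L {v \<in> carrier L. Q v}" "\<And>x. x \<in> topspace X \<Longrightarrow> Q (i x)" "v \<in> carrier L"
  shows "Q v"
proof -
  have "{v \<in> carrier L. Q v} = carrier L"
    by (rule free_lcs_generated[OF F free assms(1)]) (use assms(2) i_closed in auto)
  then show ?thesis using assms(3) by blast
qed

lemma finite_dual_support:
  assumes "\<And>j. continuous_functional (\<delta> j)"
    and "\<And>x. x \<in> topspace X \<Longrightarrow> finite {j. \<delta> j (i x) \<noteq> 0}" and "v \<in> carrier L"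
  shows "finite {j. \<delta> j v \<noteq> 0}"
proof (rule generated[of "\<lambda>v. finite {j. \<delta> j v \<noteq> 0}"])
  have add: "\<delta> j (x \<oplus> y) = \<delta> j x + \<delta> j y" if "x \<in> carrier L" "y \<in> carrier L" for j x y
    using assms(1) that by (simp add: continuous_functional_def)
  have smult: "\<delta> j (a \<odot> x) = a * \<delta> j x" if "a \<in> F" "x \<in> carrier L" for j a x
    using assms(1) that by (simp add: continuous_functional_def)
  show "linear_subspace F L {v \<in> carrier L. finite {j. \<delta> j v \<noteq> 0}}"
    unfolding linear_subspace_def
  proof (intro conjI ballI)
    fix x y assume xy: "x \<in> {v \<in> carrier L. finite {j. \<delta> j v \<noteq> 0}}" "y \<in> {v \<in> carrier L. finite {j. \<delta> j v \<noteq> 0}}"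
    have "{j. \<delta> j (x \<oplus> y) \<noteq> 0} \<subseteq> {j. \<delta> j x \<noteq> 0} \<union> {j. \<delta> j y \<noteq> 0}"
      using xy by (auto simp: add)
    then show "x \<oplus> y \<in> {v \<in> carrier L. finite {j. \<delta> j v \<noteq> 0}}"
      using xy by (auto intro: finite_subset)
  next
    fix a x assume ax: "a \<in> F" "x \<in> {v \<in> carrier L. finite {j. \<delta> j v \<noteq> 0}}"
    have "{j. \<delta> j (a \<odot> x) \<noteq> 0} \<subseteq> {j. \<delta> j x \<noteq> 0}"
      using ax by (auto simp: smult)
    then show "a \<odot> x \<in> {v \<in> carrier L. finite {j. \<delta> j v \<noteq> 0}}"
      using ax by (auto intro: finite_subset)
  qed (auto simp: functional_zero[OF assms(1)])
qed (use assms in auto)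

text \<open>Both sides are linear in \<open>v\<close>, and sums of convergent series converge, so
  the expansion passes from the points of \<open>X\<close> to their span.\<close>

lemma functional_sums:
  assumes \<delta>: "\<And>j. continuous_functional (\<delta> j)" and \<eta>: "continuous_functional \<eta>"
    and "\<And>x. x \<in> topspace X \<Longrightarrow> (\<lambda>j. c j * \<delta> j (i x)) sums \<eta> (i x)" and "v \<in> carrier L"
  shows "(\<lambda>j. c j * \<delta> j v) sums \<eta> v"
proof (rule generated[of "\<lambda>v. (\<lambda>j. c j * \<delta> j v) sums \<eta> v"])
  show "linear_subspace F L {v \<in> carrier L. (\<lambda>j. c j * \<delta> j v) sums \<eta> v}"
    unfolding linear_subspace_def
  proof (intro conjI ballI)
    fix x y assume xy: "x \<in> {v \<in> carrier L. (\<lambda>j. c j * \<delta> j v) sums \<eta> v}"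
      "y \<in> {v \<in> carrier L. (\<lambda>j. c j * \<delta> j v) sums \<eta> v}"
    then have "(\<lambda>j. c j * \<delta> j x + c j * \<delta> j y) sums (\<eta> x + \<eta> y)"
      by (intro sums_add) auto
    then show "x \<oplus> y \<in> {v \<in> carrier L. (\<lambda>j. c j * \<delta> j v) sums \<eta> v}"
      using xy \<delta> \<eta> by (simp add: continuous_functional_def distrib_left)
  next
    fix a x assume ax: "a \<in> F" "x \<in> {v \<in> carrier L. (\<lambda>j. c j * \<delta> j v) sums \<eta> v}"
    then have "(\<lambda>j. a * (c j * \<delta> j x)) sums (a * \<eta> x)"
      by (intro sums_mult) auto
    then show "a \<odot> x \<in> {v \<in> carrier L. (\<lambda>j. c j * \<delta> j v) sums \<eta> v}"
      using ax \<delta> \<eta> by (simp add: continuous_functional_def mult.left_commute)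
  qed (auto simp: functional_zero[OF \<delta>] functional_zero[OF \<eta>])
qed (use assms in auto)

section \<open>Finite \<open>X\<close>: coordinatewise choice of sequences\<close>

lemma kappa_Frechet_Urysohn_if_finite:
  assumes "Hausdorff_space X" "finite (topspace X)"
  shows "kappa_Frechet_Urysohn_space T"
  unfolding kappa_Frechet_Urysohn_space_def
proof (intro allI impI, elim conjE)
  have X: "X = discrete_topology (topspace X)"
    using assms finite_t1_space_imp_discrete_topology Hausdorff_imp_t1_space by blast
  \<comment> \<open>The coordinate functionals extend the indicator functions of points, which are
    continuous because a finite Hausdorff space is discrete.\<close>
  have "\<exists>\<delta>. continuous_functional \<delta> \<and> (\<forall>y\<in>topspace X. \<delta> (i y) = (if x = y then 1 else 0))" for x
  proof -
    have "continuous_map X euclidean (\<lambda>y. if x = y then 1 else 0 :: complex)"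
      by (subst X) simp
    moreover have "(\<lambda>y. if x = y then 1 else 0 :: complex) ` topspace X \<subseteq> F"
      using scalar_closed by auto
    ultimately show ?thesis by (rule extend_functional) blast
  qed
  then obtain \<delta> where \<delta>: "\<And>x. continuous_functional (\<delta> x)"
    "\<And>x y. y \<in> topspace X \<Longrightarrow> \<delta> x (i y) = (if x = y then 1 else 0)"
    by metis
  have \<delta>F: "\<delta> x v \<in> F" if "v \<in> carrier L" for x v
    using \<delta>(1)[of x] that by (auto simp: continuous_functional_def)
  define S where "S v = finsum L (\<lambda>x. \<delta> x v \<odot> i x) (topspace X)" for v
  have S: "v = S v" if "v \<in> carrier L" for v
  proof (rule generated[OF _ _ that])
    show "linear_subspace F L {v \<in> carrier L. v = S v}"
      unfolding linear_subspace_def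
    proof (intro conjI ballI)
      have "S \<zero> = finsum L (\<lambda>x. \<zero>) (topspace X)"
        unfolding S_def using functional_zero[OF \<delta>(1)] i_closed
        by (intro finsum_cong') auto
      then show "\<zero> \<in> {v \<in> carrier L. v = S v}" by simp
    next
      fix x y assume xy: "x \<in> {v \<in> carrier L. v = S v}" "y \<in> {v \<in> carrier L. v = S v}"
      have "S (x \<oplus> y) = finsum L (\<lambda>z. \<delta> z x \<odot> i z \<oplus> \<delta> z y \<odot> i z) (topspace X)"
        unfolding S_def using xy \<delta>(1) \<delta>F i_closed
        by (intro finsum_cong') (auto simp: continuous_functional_def smult_l_distr[simplified])
      also have "\<dots> = S x \<oplus> S y"
        unfolding S_def using xy \<delta>F i_closed by (intro finsum_addf) auto
      finally show "x \<oplus> y \<in> {v \<in> carrier L. v = S v}" using xy by auto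
    next
      fix a x assume ax: "a \<in> F" "x \<in> {v \<in> carrier L. v = S v}"
      have "S (a \<odot> x) = finsum L (\<lambda>z. a \<odot> (\<delta> z x \<odot> i z)) (topspace X)"
        unfolding S_def using ax \<delta>(1) \<delta>F i_closed
        by (intro finsum_cong') (auto simp: continuous_functional_def smult_assoc1[simplified])
      also have "\<dots> = a \<odot> S x"
        unfolding S_def using ax \<delta>F i_closed assms(2) by (intro finsum_smult_ldistr[symmetric]) auto
      finally show "a \<odot> x \<in> {v \<in> carrier L. v = S v}" using ax by auto
    qed auto
  next
    fix y assume y: "y \<in> topspace X"
    have "S (i y) = finsum L (\<lambda>x. if y = x then i x else \<zero>) (topspace X)"
      unfolding S_def using y \<delta>(2) i_closed
      by (intro finsum_cong') auto
    then show "i y = S (i y)"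
      using add.finprod_singleton[OF y assms(2), of i] i_closed by simp
  qed
  fix U y assume U: "openin T U" and y: "y \<in> T closure_of U"
  have yL: "y \<in> carrier L" using y by (auto simp: in_closure_of topspace_T)
  have "\<exists>u\<in>U. \<forall>x\<in>topspace X. norm (\<delta> x u - \<delta> x y) < inverse (real (Suc n))" for n
  proof -
    \<comment> \<open>The vectors whose finitely many coordinates are close to those of
      \<open>y\<close>. The factor \<open>topspace T\<close> is what remains of this set when
      \<open>X\<close> is empty.\<close>
    let ?W = "topspace T \<inter> (\<Inter>x\<in>topspace X. {v \<in> topspace T. \<delta> x v \<in> ball (\<delta> x y) (inverse (real (Suc n)))})"
    have "openin T ?W"
    proof (cases "topspace X = {}")
      case False
      have "openin T {v \<in> topspace T. \<delta> x v \<in> ball (\<delta> x y) (inverse (real (Suc n)))}" for x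
        using \<delta>(1)[of x] by (intro openin_continuous_map_preimage) (auto simp: continuous_functional_def)
      then show ?thesis
        using assms(2) False by (intro openin_Int openin_INT2) auto
    qed simp
    moreover have "y \<in> ?W" using yL by (auto simp: topspace_T)
    ultimately obtain u where "u \<in> U" "u \<in> ?W"
      using y unfolding in_closure_of by meson
    then show ?thesis by (auto simp: dist_norm norm_minus_commute intro!: bexI[of _ u])
  qed
  then obtain u where u: "\<And>n. u n \<in> U"
    "\<And>n x. x \<in> topspace X \<Longrightarrow> norm (\<delta> x (u n) - \<delta> x y) < inverse (real (Suc n))"
    by metis
  have uL: "u n \<in> carrier L" for n
    using u(1) openin_subset[OF U] by (auto simp: topspace_T)
  have "(\<lambda>n. \<delta> x (u n)) \<longlonglongrightarrow> \<delta> x y" if "x \<in> topspace X" for x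
    by (subst Lim_null, rule Lim_null_comparison[OF _ LIMSEQ_inverse_real_of_nat])
      (use u(2)[OF that] in \<open>auto intro!: always_eventually less_imp_le\<close>)
  \<comment> \<open>Convergent coordinates suffice, since \<open>S\<close> is a finite sum of fixed
    vectors with these coefficients and the vector operations are continuous.\<close>
  then have "limitin T (\<lambda>n. S (u n)) (S y) sequentially"
    unfolding S_def using \<delta>F uL yL i_closed assms(2)
    by (intro limitin_finsum limitin_smult) (auto simp: topspace_T)
  then have "limitin T u y sequentially"
    using S uL yL by simp
  then show "\<exists>s. range s \<subseteq> U \<and> limitin T s y sequentially"
    using u(1) by (intro exI[of _ u]) auto
qed

section \<open>Infinite \<open>X\<close>: disjoint bumps and null sequences\<close>

lemma finite_disjoint_dual_support:
  fixes b :: "nat \<Rightarrow> 'x \<Rightarrow> real"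
  assumes disj: "\<And>m n x. x \<in> topspace X \<Longrightarrow> b m x \<noteq> 0 \<Longrightarrow> b n x \<noteq> 0 \<Longrightarrow> m = n"
    and \<delta>: "\<And>j. continuous_functional (\<delta> j)" "\<And>j x. x \<in> topspace X \<Longrightarrow> \<delta> j (i x) = of_real (b j x)"
    and v: "v \<in> carrier L"
  shows "finite {j. \<delta> j v \<noteq> 0}"
proof (rule finite_dual_support[OF \<delta>(1) _ v])
  fix x assume x: "x \<in> topspace X"
  have "{j. \<delta> j (i x) \<noteq> 0} \<subseteq> {SOME j. b j x \<noteq> 0}"
    using disj[OF x] \<delta>(2)[OF x] by (auto intro: someI2)
  then show "finite {j. \<delta> j (i x) \<noteq> 0}" by (rule finite_subset) simp
qed

text \<open>Gliding humps along \<open>v\<close> yield a series \<open>h\<close> of bumps,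
  continuous by \<open>tails\<close>, whose extension stays at least 1 in norm on a subsequence of
  \<open>v\<close>. The predicate \<open>P\<close> is left open because the lemma serves twice: with
  values growing geometrically, where the coefficients are small, and with merely nonzero values,
  where the bumps are locally finite.\<close>

lemma null_sequence_no_hump:
  fixes b :: "nat \<Rightarrow> 'x \<Rightarrow> real" and P :: "nat \<Rightarrow> nat \<Rightarrow> nat \<Rightarrow> bool"
  assumes b: "\<And>j. continuous_map X euclideanreal (b j)"
    and disj: "\<And>m n x. x \<in> topspace X \<Longrightarrow> b m x \<noteq> 0 \<Longrightarrow> b n x \<noteq> 0 \<Longrightarrow> m = n"
    and \<delta>: "\<And>j. continuous_functional (\<delta> j)" "\<And>j x. x \<in> topspace X \<Longrightarrow> \<delta> j (i x) = of_real (b j x)"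
    and v: "range v \<subseteq> carrier L" "limitin T v \<zero> sequentially"
    and P: "\<And>m n. \<exists>k\<ge>n. \<exists>j\<ge>n. P m k j" "\<And>m k j. P m k j \<Longrightarrow> \<delta> j (v k) \<noteq> 0"
    and tails: "\<And>K J x e. strict_mono K \<Longrightarrow> strict_mono J \<Longrightarrow> (\<And>m. P m (K m) (J m)) \<Longrightarrow> x \<in> topspace X \<Longrightarrow> 0 < e \<Longrightarrow>
      \<exists>N M. openin X N \<and> x \<in> N \<and> (\<forall>y\<in>N. \<forall>m\<ge>M. norm (2 / \<delta> (J m) (v (K m)) * b (J m) y) < e)"
  shows False
proof -
  have vL: "v k \<in> carrier L" for k using v(1) by blast
  have rows: "finite {j. \<delta> j (v k) \<noteq> 0}" for k
    by (rule finite_disjoint_dual_support[OF disj \<delta> vL])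
  obtain K J where mono: "strict_mono K" "strict_mono J" and KJ: "\<And>m. P m (K m) (J m)"
    and zero: "\<And>l m. l < m \<Longrightarrow> \<delta> (J m) (v (K l)) = 0"
    and small: "\<And>m. norm (\<Sum>l<m. 2 / \<delta> (J l) (v (K l)) * \<delta> (J l) (v (K m))) \<le> 1"
    using gliding_hump[of "\<lambda>k j. \<delta> j (v k)" P, OF rows functional_null_sequence[OF \<delta>(1) v(2)] P(1)]
    by blast
  define c where "c m = 2 / \<delta> (J m) (v (K m))" for m
  have cF: "c m \<in> F" for m
    using \<delta>(1)[of "J m"] vL scalar_closed(3)[of 2] unfolding c_def
    by (intro scalar_closed) (auto simp: continuous_functional_def)
  define h where "h x = (\<Sum>m. c m * of_real (b (J m) x))" for x
  \<comment> \<open>Strict monotonicity makes \<open>J\<close> injective, so the selected bumps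
    still have disjoint supports.\<close>
  have one: "m = n" if "x \<in> topspace X" "c m * of_real (b (J m) x) \<noteq> 0" "c n * of_real (b (J n) x) \<noteq> 0" for x m n
    using disj[OF that(1), of "J m" "J n"] that mono(2) by (auto simp: strict_mono_eq)
  have "continuous_map X euclidean h"
  proof (rule continuous_map_locally_approximable)
    fix x and e :: real assume x: "x \<in> topspace X" and e: "0 < e"
    obtain N M where N: "openin X N" "x \<in> N" "\<And>y m. y \<in> N \<Longrightarrow> m \<ge> M \<Longrightarrow> norm (c m * b (J m) y) < e"
      using tails[OF mono KJ x e] unfolding c_def by blast
    have "continuous_map X euclidean (\<lambda>y. c m * complex_of_real (b (J m) y))" for m
      using continuous_map_compose[OF b, of euclidean "\<lambda>r. c m * complex_of_real r"]
      by (simp add: o_def continuous_on_mult_left continuous_on_of_real)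
    then have "continuous_map X euclidean (\<lambda>y. \<Sum>m<M. c m * of_real (b (J m) y))"
      by (intro continuous_intros) auto
    moreover have "norm (h y - (\<Sum>m<M. c m * of_real (b (J m) y))) < e" if "y \<in> N" for y
      unfolding h_def
    proof (rule suminf_diff_at_most_one_term[OF one e])
      show "y \<in> topspace X" using that openin_subset[OF N(1)] by blast
    qed (use N(3) that in auto)
    ultimately show "\<exists>N g. openin X N \<and> x \<in> N \<and> continuous_map X euclidean g \<and> (\<forall>y\<in>N. norm (h y - g y) < e)"
      using N(1,2) by blast
  qed
  moreover have "h ` topspace X \<subseteq> F"
  proof
    fix z assume "z \<in> h ` topspace X"
    then obtain x where x: "x \<in> topspace X" "z = h x" by blast
    have "h x \<in> insert 0 (range (\<lambda>m. c m * of_real (b (J m) x)))"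
      unfolding h_def by (rule suminf_at_most_one_term) (rule one[OF x(1)])
    then show "z \<in> F"
      using x(2) cF by (auto intro!: scalar_closed)
  qed
  ultimately obtain \<eta> where \<eta>: "continuous_functional \<eta>" "\<And>x. x \<in> topspace X \<Longrightarrow> \<eta> (i x) = h x"
    by (rule extend_functional) blast
  have \<eta>_sums: "(\<lambda>m. c m * \<delta> (J m) u) sums \<eta> u" if "u \<in> carrier L" for u
  proof (rule functional_sums[OF \<delta>(1) \<eta>(1) _ that])
    fix x assume x: "x \<in> topspace X"
    have "(\<lambda>m. c m * of_real (b (J m) x)) sums h x"
      unfolding h_def by (rule sums_at_most_one_term) (rule one[OF x])
    then show "(\<lambda>m. c m * \<delta> (J m) (i x)) sums \<eta> (i x)"
      by (simp add: \<eta>(2) \<delta>(2) x)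
  qed
  have "1 \<le> norm (\<eta> (v (K m)))" for m
  proof -
    \<comment> \<open>Terms beyond \<open>m\<close> vanish because \<open>J l\<close> avoids the
      support of row \<open>K m\<close>. The term at \<open>m\<close> is exactly 2 by the choice of
      \<open>c m\<close>, and the earlier ones add up to at most 1 in norm.\<close>
    have "(\<lambda>l. c l * \<delta> (J l) (v (K m))) sums (\<Sum>l<Suc m. c l * \<delta> (J l) (v (K m)))"
      by (rule sums_finite) (use zero in auto)
    then have "\<eta> (v (K m)) = (\<Sum>l<Suc m. c l * \<delta> (J l) (v (K m)))"
      using \<eta>_sums[OF vL] sums_unique2 by blast
    also have "\<dots> = (\<Sum>l<m. c l * \<delta> (J l) (v (K m))) + 2"
      using P(2)[OF KJ[of m]] by (simp add: c_def)
    finally show ?thesis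
      using small[of m] norm_triangle_ineq2[of 2 "- (\<Sum>l<m. c l * \<delta> (J l) (v (K m)))"]
      by (simp add: c_def add.commute)
  qed
  moreover have "(\<lambda>m. \<eta> (v (K m))) \<longlonglongrightarrow> 0"
    using LIMSEQ_subseq_LIMSEQ[OF functional_null_sequence[OF \<eta>(1) v(2)] mono(1)] by (simp add: o_def)
  ultimately have "(1::real) \<le> norm (0::complex)"
    by (intro LIMSEQ_le_const[OF tendsto_norm]) auto
  then show False by simp
qed

lemma closedin_functional:
  assumes "continuous_functional \<delta>" "closed C"
  shows "closedin T {u \<in> carrier L. \<delta> u \<in> C}"
  using closedin_continuous_map_preimage[of T euclidean \<delta> C] assms
  by (simp add: continuous_functional_def topspace_T)

text \<open>If no \<open>A n\<close> were a neighbourhood of 0, a null sequence would leave each of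
  them. It would have humps larger than \<open>2 ^ m\<close>, and dividing by these gives
  coefficients so small that the resulting series of bumps, all bounded by 1, has uniformly small
  tails.\<close>

lemma unit_ball_multiple_neighbourhood:
  fixes b :: "nat \<Rightarrow> 'x \<Rightarrow> real"
  assumes kFU: "kappa_Frechet_Urysohn_space T"
    and b: "\<And>j. continuous_map X euclideanreal (b j)" "\<And>j x. 0 \<le> b j x" "\<And>j x. b j x \<le> 1"
    and p: "\<And>j. p j \<in> topspace X" "\<And>j. b j (p j) = 1"
    and disj: "\<And>m n x. x \<in> topspace X \<Longrightarrow> b m x \<noteq> 0 \<Longrightarrow> b n x \<noteq> 0 \<Longrightarrow> m = n"
    and \<delta>: "\<And>j. continuous_functional (\<delta> j)" "\<And>j x. x \<in> topspace X \<Longrightarrow> \<delta> j (i x) = of_real (b j x)"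
  obtains n :: nat and V where "openin T V" "\<zero> \<in> V" "\<And>u j. u \<in> V \<Longrightarrow> norm (\<delta> j u) \<le> real n"
proof (rule ccontr)
  assume no_thesis: "\<not> thesis"
  note nbhd = that
  define A where "A n = {u \<in> carrier L. \<forall>j. norm (\<delta> j u) \<le> real n}" for n
  have "closedin T (A n)" for n
  proof -
    have "A n = (\<Inter>j. {u \<in> carrier L. \<delta> j u \<in> cball 0 (real n)})"
      by (auto simp: A_def)
    moreover have "closedin T {u \<in> carrier L. \<delta> j u \<in> cball 0 (real n)}" for j
      by (intro closedin_functional \<delta>(1)) simp
    ultimately show ?thesis by (simp only:) (rule closedin_INT, auto)
  qed
  moreover have "incseq A" by (auto simp: incseq_def A_def intro: order_trans[OF _ of_nat_mono])
  moreover have "\<not> V \<subseteq> A n" if "openin T V" "\<zero> \<in> V" for n V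
    using no_thesis nbhd[OF that, of n] by (auto simp: A_def)
  moreover have "i (p 0) \<noteq> \<zero>" "i (p 0) \<in> carrier L"
    using functional_zero[OF \<delta>(1), of 0] \<delta>(2)[OF p(1), of 0 0] p i_closed by auto
  ultimately obtain v where v: "range v \<subseteq> carrier L" "limitin T v \<zero> sequentially" "\<And>n. \<exists>k. v k \<notin> A n"
    using kappa_Frechet_Urysohn_null_sequence[OF kFU] by metis
  have vL: "v k \<in> carrier L" for k using v(1) by blast
  have rows: "finite {j. \<delta> j (v k) \<noteq> 0}" for k
    by (rule finite_disjoint_dual_support[OF disj \<delta> vL])
  have hump: "\<exists>k\<ge>n. \<exists>j\<ge>n. 2 ^ m < norm (\<delta> j (v k))" for m n
  proof -
    \<comment> \<open>The entries with a column or a row index below \<open>n\<close>. They are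
      bounded, as columns converge and rows have only finitely many nonzero entries, so an entry
      exceeding the bound has both indices at least \<open>n\<close>.\<close>
    let ?B = "(\<Union>j<n. range (\<lambda>k. \<delta> j (v k))) \<union> (\<Union>k<n. range (\<lambda>j. \<delta> j (v k)))"
    have "bounded (range (\<lambda>k. \<delta> j (v k)))" for j
      using functional_null_sequence[OF \<delta>(1) v(2)] by (rule convergent_imp_bounded)
    moreover have "bounded (range (\<lambda>j. \<delta> j (v k)))" for k
    proof (rule finite_imp_bounded, rule finite_subset)
      show "range (\<lambda>j. \<delta> j (v k)) \<subseteq> insert 0 ((\<lambda>j. \<delta> j (v k)) ` {j. \<delta> j (v k) \<noteq> 0})" by auto
    qed (use rows in auto)
    ultimately have "bounded ?B"
      unfolding bounded_Un by (intro conjI bounded_UN) auto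
    then obtain a where a: "\<And>z. z \<in> ?B \<Longrightarrow> norm z \<le> a" unfolding bounded_iff by blast
    obtain N :: nat where N: "max a (2 ^ m) \<le> real N" using real_arch_simple by blast
    obtain k j where kj: "real N < norm (\<delta> j (v k))"
      using v(3)[of N] vL by (auto simp: A_def not_le)
    then have "\<delta> j (v k) \<notin> ?B" using a[of "\<delta> j (v k)"] N by auto
    then have "k \<ge> n" "j \<ge> n" by (auto simp: not_less[symmetric])
    moreover have "2 ^ m < norm (\<delta> j (v k))" using kj N max.cobounded2[of "2 ^ m" a] by linarith
    ultimately show ?thesis by blast
  qed
  show False
  proof (rule null_sequence_no_hump[where P = "\<lambda>m k j. 2 ^ m < norm (\<delta> j (v k))",
      OF b(1) disj \<delta> v(1,2) hump])
    fix K J :: "nat \<Rightarrow> nat" and x and e :: real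
    assume KJ: "\<And>m. 2 ^ m < norm (\<delta> (J m) (v (K m)))" and x: "x \<in> topspace X" and e: "0 < e"
    obtain M where M: "2 / e < 2 ^ M" using real_arch_pow[of 2 "2 / e"] by auto
    have "norm (2 / \<delta> (J m) (v (K m)) * b (J m) y) < e" if "m \<ge> M" for m y
    proof -
      have "norm (2 / \<delta> (J m) (v (K m)) * b (J m) y) = norm (2 / \<delta> (J m) (v (K m))) * b (J m) y"
        unfolding norm_mult norm_of_real using b(2) by simp
      also have "\<dots> \<le> norm (2 / \<delta> (J m) (v (K m)))"
        using b(2,3) by (intro mult_left_le) auto
      also have "\<dots> < e"
      proof -
        have "2 / e < norm (\<delta> (J m) (v (K m)))"
          using M KJ[of m] power_increasing[OF that, of "2::real"] by linarith
        moreover have "0 < norm (\<delta> (J m) (v (K m)))"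
          using KJ[of m] by (rule less_trans[rotated]) simp
        ultimately show ?thesis
          using e by (simp add: norm_divide field_simps)
      qed
      finally show ?thesis .
    qed
    then show "\<exists>N M. openin X N \<and> x \<in> N \<and> (\<forall>y\<in>N. \<forall>m\<ge>M. norm (2 / \<delta> (J m) (v (K m)) * b (J m) y) < e)"
      using x by (intro exI[of _ "topspace X"] exI[of _ M]) auto
  qed auto
qed

text \<open>A uniform bound on the \<open>\<delta> j\<close> near 0, transported to \<open>X\<close>
  by the continuous map \<open>i\<close>, makes the truncated bumps locally finite. Their series are
  then continuous for any coefficients, so nonzero entries already count as humps.\<close>

lemma finite_if_kappa_Frechet_Urysohn:
  assumes X: "completely_regular_space X" "Hausdorff_space X"
    and kFU: "kappa_Frechet_Urysohn_space T"
  shows "finite (topspace X)"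
proof (rule ccontr)
  assume "infinite (topspace X)"
  then obtain b :: "nat \<Rightarrow> 'x \<Rightarrow> real" and p where
    b: "\<And>j. continuous_map X euclideanreal (b j)" "\<And>j x. 0 \<le> b j x" "\<And>j x. b j x \<le> 1"
    and p: "\<And>j. p j \<in> topspace X" "\<And>j. b j (p j) = 1"
    and disj: "\<And>m n x. x \<in> topspace X \<Longrightarrow> b m x \<noteq> 0 \<Longrightarrow> b n x \<noteq> 0 \<Longrightarrow> m = n"
    using disjoint_bumps[OF X] by metis
  have extend: "\<exists>\<delta>. continuous_functional \<delta> \<and> (\<forall>x\<in>topspace X. \<delta> (i x) = of_real (f x))"
    if "continuous_map X euclideanreal f" for f
  proof -
    have "continuous_map X euclidean (\<lambda>y. complex_of_real (f y))"
      using continuous_map_compose[OF that, of euclidean complex_of_real]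
      by (simp add: o_def continuous_on_of_real)
    moreover have "(\<lambda>y. complex_of_real (f y)) ` topspace X \<subseteq> F"
      using scalar_closed by auto
    ultimately show ?thesis by (rule extend_functional) blast
  qed
  obtain \<delta> where \<delta>: "\<And>j. continuous_functional (\<delta> j)"
      "\<And>j x. x \<in> topspace X \<Longrightarrow> \<delta> j (i x) = of_real (b j x)"
    using extend[OF b(1)] by metis
  obtain n :: nat and V where V: "openin T V" "\<zero> \<in> V" "\<And>u j. u \<in> V \<Longrightarrow> norm (\<delta> j u) \<le> real n"
    by (rule unit_ball_multiple_neighbourhood[where b = b and p = p and \<delta> = \<delta>, OF kFU b p])
      (erule (2) disj, rule \<delta>(1), erule \<delta>(2), rule that)
  \<comment> \<open>Positive exactly where \<open>b j x > 1 / 2\<close>, with value 1 still attained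
    at \<open>p j\<close>; making \<open>b j\<close> at most \<open>1 / 2\<close> near a point is
    thus enough to make \<open>g j\<close> vanish there.\<close>
  define g where "g j x = max 0 (2 * b j x - 1)" for j x
  have g: "continuous_map X euclideanreal (g j)" for j
    unfolding g_def by (intro continuous_intros b(1))
  have g_disj: "j = k" if "x \<in> topspace X" "g j x \<noteq> 0" "g k x \<noteq> 0" for j k x
    using that disj[OF that(1), of j k] by (auto simp: g_def max_def split: if_splits)
  have g_locally_finite: "\<exists>N k. openin X N \<and> x \<in> N \<and> (\<forall>y\<in>N. \<forall>j\<ge>k. g j y = 0)"
    if x: "x \<in> topspace X" for x
  proof -
    \<comment> \<open>If \<open>c\<close> times \<open>i y \<ominus> i x\<close> lies in
      \<open>V\<close> and \<open>b j x = 0\<close>, then \<open>b j y\<close> is at most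
      \<open>n / (4 * (n + 1))\<close>, which is below \<open>1 / 2\<close>.\<close>
    define c where "c = complex_of_real (4 * (real n + 1))"
    have c: "c \<in> F" unfolding c_def by (rule scalar_closed)
    have "continuous_map X T (\<lambda>y. i y \<oplus> (- 1) \<odot> i x)"
      using x i_closed scalar_closed by (intro continuous_map_add continuous_i) (auto simp: topspace_T)
    then have "continuous_map X T (\<lambda>y. c \<odot> (i y \<ominus> i x))"
      using x i_closed c by (intro continuous_map_smult) (auto simp: a_minus_def minus_eq_smult)
    then have "openin X {y \<in> topspace X. c \<odot> (i y \<ominus> i x) \<in> V}" (is "openin X ?N")
      using V(1) by (rule openin_continuous_map_preimage)
    moreover have "x \<in> ?N"
      using x V(2) i_closed[OF x] c r_neg[of "i x"] smult_r_null[of c] by (simp add: a_minus_def)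
    \<comment> \<open>At most one bump is nonzero at \<open>x\<close>, so \<open>k\<close> only has
      to exceed its index.\<close>
    moreover have "\<exists>k. \<forall>j\<ge>k. b j x = 0"
      using disj[OF x] by (metis Suc_n_not_le_n)
    then obtain k where k: "\<And>j. j \<ge> k \<Longrightarrow> b j x = 0" by blast
    have "g j y = 0" if "y \<in> ?N" "j \<ge> k" for j y
    proof -
      have "\<delta> j (c \<odot> (i y \<ominus> i x)) = c * of_real (b j y)"
        using \<delta>(1)[of j] c that x i_closed k[OF that(2)] functional_diff[OF \<delta>(1)]
        by (simp add: continuous_functional_def \<delta>(2))
      moreover have "norm (\<delta> j (c \<odot> (i y \<ominus> i x))) \<le> real n"
        using V(3) that(1) by blast
      ultimately have "norm c * b j y \<le> real n"
        using b(2) by (simp add: norm_mult)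
      moreover have "norm c = 4 * (real n + 1)"
        unfolding c_def norm_of_real by simp
      ultimately have le: "4 * (real n + 1) * b j y \<le> real n" by simp
      have "b j y \<le> 1 / 2"
      proof (rule ccontr)
        assume "\<not> b j y \<le> 1 / 2"
        then have "4 * (real n + 1) * (1 / 2) \<le> 4 * (real n + 1) * b j y"
          by (intro mult_left_mono) auto
        then have "4 * (real n + 1) * (1 / 2) \<le> real n"
          using le by (rule order_trans)
        then show False by simp
      qed
      then show ?thesis by (simp add: g_def)
    qed
    ultimately show ?thesis by blast
  qed
  obtain \<gamma> where \<gamma>: "\<And>j. continuous_functional (\<gamma> j)"
      "\<And>j x. x \<in> topspace X \<Longrightarrow> \<gamma> j (i x) = of_real (g j x)"
    using extend[OF g] by metis
  define A where "A n = {u \<in> carrier L. \<forall>j\<ge>n. \<gamma> j u = 0}" for n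
  have "closedin T (A n)" for n
  proof -
    have "A n = (\<Inter>j\<in>{n..}. {u \<in> carrier L. \<gamma> j u \<in> {0}})"
      by (auto simp: A_def)
    moreover have "closedin T {u \<in> carrier L. \<gamma> j u \<in> {0}}" for j
      by (intro closedin_functional \<gamma>(1)) simp
    ultimately show ?thesis by (simp only:) (rule closedin_INT, auto)
  qed
  moreover have "incseq A" by (auto simp: incseq_def A_def)
  \<comment> \<open>Small multiples of \<open>i (p n)\<close> lie in any neighbourhood of 0, but
    \<open>\<gamma> n\<close> does not vanish on them, as \<open>g n (p n) = 1\<close>.\<close>
  moreover have "\<not> V \<subseteq> A n" if V: "openin T V" "\<zero> \<in> V" for n V
  proof
    assume "V \<subseteq> A n"
    let ?c = "\<lambda>k. complex_of_real (inverse (real (Suc k)))"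
    have "?c \<longlonglongrightarrow> 0"
      using tendsto_of_real[OF LIMSEQ_inverse_real_of_nat, where 'a = complex] by simp
    moreover have "range ?c \<subseteq> F" using scalar_closed(3) by blast
    ultimately have "limitin T (\<lambda>k. ?c k \<odot> i (p n)) (0 \<odot> i (p n)) sequentially"
      using scalar_closed i_closed[OF p(1)] by (intro limitin_smult) (auto simp: topspace_T)
    then have "\<forall>\<^sub>F k in sequentially. ?c k \<odot> i (p n) \<in> V"
      by (rule limitinD) (use V i_closed[OF p(1)] in auto)
    then obtain k where "?c k \<odot> i (p n) \<in> V"
      using eventually_happens'[OF sequentially_bot] by blast
    then have "\<gamma> n (?c k \<odot> i (p n)) = 0" using \<open>V \<subseteq> A n\<close> by (auto simp: A_def)
    moreover have "\<gamma> n (?c k \<odot> i (p n)) = ?c k * \<gamma> n (i (p n))"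
      using \<gamma>(1)[of n] i_closed[OF p(1)] scalar_closed(3) unfolding continuous_functional_def by blast
    ultimately show False
      using \<gamma>(2)[OF p(1), of n n] p(2) by (simp add: g_def del: of_nat_Suc)
  qed
  moreover have "i (p 0) \<noteq> \<zero>" "i (p 0) \<in> carrier L"
    using functional_zero[OF \<delta>(1), of 0] \<delta>(2)[OF p(1), of 0 0] p i_closed by auto
  ultimately obtain v where v: "range v \<subseteq> carrier L" "limitin T v \<zero> sequentially" "\<And>n. \<exists>k. v k \<notin> A n"
    using kappa_Frechet_Urysohn_null_sequence[OF kFU] by metis
  have vL: "v k \<in> carrier L" for k using v(1) by blast
  have rows: "finite {j. \<gamma> j (v k) \<noteq> 0}" for k
    by (rule finite_disjoint_dual_support[OF g_disj \<gamma> vL])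
  have hump: "\<exists>k\<ge>n. \<exists>j\<ge>n. \<gamma> j (v k) \<noteq> 0" for n
  proof -
    have "finite (\<Union>k<n. {j. \<gamma> j (v k) \<noteq> 0})" using rows by auto
    then obtain M where M: "\<And>j. j \<in> (\<Union>k<n. {j. \<gamma> j (v k) \<noteq> 0}) \<Longrightarrow> j < M"
      using finite_nat_set_iff_bounded by meson
    \<comment> \<open>Rows before \<open>n\<close> are supported below \<open>M\<close>, so a
      nonzero entry in a column from \<open>M\<close> on belongs to a row from \<open>n\<close>
      on.\<close>
    obtain k j where kj: "j \<ge> max n M" "\<gamma> j (v k) \<noteq> 0"
      using v(3)[of "max n M"] vL by (auto simp: A_def)
    then have "k \<ge> n" using M[of j] by force
    then show ?thesis using kj by auto
  qed
  show False
  proof (rule null_sequence_no_hump[where P = "\<lambda>m k j. \<gamma> j (v k) \<noteq> 0",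
      OF g g_disj \<gamma> v(1,2) hump])
    fix K J :: "nat \<Rightarrow> nat" and x and e :: real
    assume J: "strict_mono J" and x: "x \<in> topspace X" and e: "0 < e"
    obtain N k where N: "openin X N" "x \<in> N" "\<And>y j. y \<in> N \<Longrightarrow> j \<ge> k \<Longrightarrow> g j y = 0"
      using g_locally_finite[OF x] by blast
    \<comment> \<open>Since \<open>J m \<ge> m \<ge> k\<close>, the bump vanishes on
      \<open>N\<close> and the size of its coefficient is irrelevant.\<close>
    have "norm (2 / \<gamma> (J m) (v (K m)) * g (J m) y) < e" if "y \<in> N" "m \<ge> k" for y m
      using N(3)[OF that(1), of "J m"] strict_mono_imp_increasing[OF J, of m] that(2) e by simp
    then show "\<exists>N M. openin X N \<and> x \<in> N \<and> (\<forall>y\<in>N. \<forall>m\<ge>M. norm (2 / \<gamma> (J m) (v (K m)) * g (J m) y) < e)"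
      using N(1,2) by blast
  qed auto
qed

end

theorem corollary2p8:
  fixes F :: "complex set"
    and X :: "'x topology"
    and L :: "(complex, 'v) module"
    and T :: "'v topology"
    and i :: "'x \<Rightarrow> 'v"
  assumes "F = \<real> \<or> F = UNIV"
    and "completely_regular_space X" and "Hausdorff_space X"
    and "free_locally_convex_space F X L T i"
  shows "kappa_Frechet_Urysohn_space T \<longleftrightarrow> finite (topspace X)"
proof -
  interpret free_lcs F L T X i
    using assms by unfold_locales (auto simp: free_locally_convex_space_def)
  show ?thesis
    using assms finite_if_kappa_Frechet_Urysohn kappa_Frechet_Urysohn_if_finite by blast
qed

end
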